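(* Let $q,p_1,\ldots,p_k$ be elements of $U(\mathfrak{sl}_2)$ and consider the following statements: (1) There exist central elements $z_0,z_1,\ldots,z_k\in\mathbb{C}[C]$ such that $z_0$ is nonzero, $z_0(c_n)\neq 0$ for every $n\in\mathbb{N}$ with $\rho_n(q)\neq 0$, and $z_0q=z_1p_1+\ldots+z_kp_k$. (2) $q\in \mathrm{Loc}_{\mathcal{I}}\{p_1,\ldots,p_k\}$. (3) $q\in \mathrm{Ref}_{\mathcal{I}}\{p_1,\ldots,p_k\}$. (4) There exist central elements $z_0,z_1,\ldots,z_k\in\mathbb{C}[C]$ such that $z_0$ is nonzero and $z_0q=z_1p_1+\ldots+z_kp_k$. Then $(1)\Rightarrow(2)\Rightarrow(3)\Rightarrow(4)$ for all such $q,p_1,\ldots,p_k$, and the reverse implications do not hold (that is, each of $(2)\Rightarrow(1)$, $(3)\Rightarrow(2)$, $(4)\Rightarrow(3)$ fails for some choice of $k$ and $q,p_1,\ldots,p_k$).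
   Context: $\mathfrak{sl}_2$ is the Lie algebra of trace-zero $2\times2$ complex matrices with standard basis $X=E_{12}$, $Y=E_{21}$, $H=E_{11}-E_{22}$, and $U(\mathfrak{sl}_2)$ is its universal enveloping algebra. $C:=XY+\frac12H^2+YX$ is the Casimir element; the center of $U(\mathfrak{sl}_2)$ is the polynomial algebra $\mathbb{C}[C]$. For $n\in\mathbb{N}=\{1,2,\ldots\}$, $\rho_n$ is the unique (up to equivalence) irreducible representation of $\mathfrak{sl}_2$ of dimension $n$, extended to $U(\mathfrak{sl}_2)$; $\rho_n(C)=c_nI_n$ with $c_n:=\frac12(n^2-1)$. For $z\in\mathbb{C}[C]$, $z(c_n)$ is the value of the polynomial $z$ at $C=c_n$. $\mathcal{I}$ is the class of all finite-dimensional irreducible representations of $U(\mathfrak{sl}_2)$. For an algebra $A$ and a class $\mathcal{C}$ of representations of $A$, $\mathrm{Loc}_{\mathcal{C}}\{p_1,\ldots,p_k\}$ is the set of all $q\in A$ such that $\pi(q)\in\mathrm{span}_{\mathbb{C}}\{\pi(p_1),\ldots,\pi(p_k)\}$ for all $\pi\in\mathcal{C}$, and $\mathrm{Ref}_{\mathcal{C}}\{p_1,\ldots,p_k\}$ is the set of all $q\in A$ such that $\pi(q)v\in\mathrm{span}_{\mathbb{C}}\{\pi(p_1)v,\ldots,\pi(p_k)v\}$ for every $\pi:A\to\mathrm{End}(V_\pi)$ in $\mathcal{C}$ and every $v\in V_\pi$. *)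

theory Defs
  imports
    Complex_Main
    "HOL-Library.Poly_Mapping"
    "HOL-Computational_Algebra.Polynomial"
    "Jordan_Normal_Form.VS_Connect"
begin

typedef sl2 = "{A :: complex mat. A \<in> carrier_mat 2 2 \<and> (\<Sum>i<2. A $$ (i, i)) = 0}"
  by (rule exI[of _ "0\<^sub>m 2 2"]) simp

setup_lifting type_definition_sl2

lemma sum_two: "(\<Sum>i<2. f i) = f 0 + f (1 :: nat)" for f :: "nat \<Rightarrow> complex"
  by (simp add: numeral_2_eq_2)

lift_definition sl2_add :: "sl2 \<Rightarrow> sl2 \<Rightarrow> sl2" is "\<lambda>A B. A + B"
proof -
  fix A B :: "complex mat"
  assume A: "A \<in> carrier_mat 2 2 \<and> (\<Sum>i<2. A $$ (i, i)) = 0"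
    and B: "B \<in> carrier_mat 2 2 \<and> (\<Sum>i<2. B $$ (i, i)) = 0"
  have "(\<Sum>i<2. (A + B) $$ (i, i)) = (\<Sum>i<2. A $$ (i, i)) + (\<Sum>i<2. B $$ (i, i))"
    using A B by (auto simp: sum_two algebra_simps)
  with A B show "A + B \<in> carrier_mat 2 2 \<and> (\<Sum>i<2. (A + B) $$ (i, i)) = 0"
    by simp
qed

lift_definition sl2_scale :: "complex \<Rightarrow> sl2 \<Rightarrow> sl2" is "\<lambda>c A. c \<cdot>\<^sub>m A"
  by (auto simp: sum_two simp flip: distrib_left)

lift_definition sl2_bracket :: "sl2 \<Rightarrow> sl2 \<Rightarrow> sl2" is "\<lambda>A B. A * B - B * A"
proof -
  fix A B :: "complex mat"
  assume A: "A \<in> carrier_mat 2 2 \<and> (\<Sum>i<2. A $$ (i, i)) = 0"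
    and B: "B \<in> carrier_mat 2 2 \<and> (\<Sum>i<2. B $$ (i, i)) = 0"
  have *: "(A * B) $$ (i, i) = A $$ (i, 0) * B $$ (0, i) + A $$ (i, 1) * B $$ (1, i)"
    "(B * A) $$ (i, i) = B $$ (i, 0) * A $$ (0, i) + B $$ (i, 1) * A $$ (1, i)"
    if "i < 2" for i
    using A B that by (auto simp: scalar_prod_def atLeast0LessThan sum_two)
  have "(\<Sum>i<2. (A * B - B * A) $$ (i, i)) = 0"
    using A B *[of 0] *[of 1] by (auto simp: sum_two mult.commute)
  with A B show "A * B - B * A \<in> carrier_mat 2 2 \<and> (\<Sum>i<2. (A * B - B * A) $$ (i, i)) = 0"
    by (auto intro!: minus_carrier_mat mult_carrier_mat)
qed

lift_definition sl2_X :: sl2 is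
  "mat 2 2 (\<lambda>(i, j). if i = 0 \<and> j = 1 then 1 else 0)"
  by (simp add: sum_two)

lift_definition sl2_Y :: sl2 is
  "mat 2 2 (\<lambda>(i, j). if i = 1 \<and> j = 0 then 1 else 0)"
  by (simp add: sum_two)

lift_definition sl2_H :: sl2 is
  "mat 2 2 (\<lambda>(i, j). if i = j then (if i = 0 then 1 else - 1) else 0)"
  by (simp add: sum_two)

datatype 'a word = Word (letters: "'a list")

instantiation word :: (type) monoid_add
begin

definition zero_word :: "'a word" where
  "zero_word = Word []"

definition plus_word :: "'a word \<Rightarrow> 'a word \<Rightarrow> 'a word" where
  "plus_word v w = Word (letters v @ letters w)"

instance
  by standard (auto simp: zero_word_def plus_word_def)

end

text \<open>Finitely supported functions on words, with the convolution product, form the free unital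
  associative algebra; below it is taken on the underlying set of \<open>sl2\<close>. The first two families of
  relations make it the tensor algebra of the vector space \<open>sl2\<close>; the third one is the usual
  relation defining the enveloping algebra.\<close>

type_synonym free_sl2 = "sl2 word \<Rightarrow>\<^sub>0 complex"

definition gen :: "sl2 \<Rightarrow> free_sl2" where
  "gen x = Poly_Mapping.single (Word [x]) 1"

definition const_free :: "complex \<Rightarrow> free_sl2" where
  "const_free c = Poly_Mapping.single 0 c"

inductive_set env_ideal :: "free_sl2 set" where
  rel_add: "gen (sl2_add x y) - (gen x + gen y) \<in> env_ideal"
| rel_scale: "gen (sl2_scale c x) - const_free c * gen x \<in> env_ideal"
| rel_bracket: "gen x * gen y - gen y * gen x - gen (sl2_bracket x y) \<in> env_ideal"
| sum: "a \<in> env_ideal \<Longrightarrow> b \<in> env_ideal \<Longrightarrow> a + b \<in> env_ideal"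
| mult_left: "a \<in> env_ideal \<Longrightarrow> r * a \<in> env_ideal"
| mult_right: "a \<in> env_ideal \<Longrightarrow> a * r \<in> env_ideal"

lemma lookup_times_zero_word:
  "Poly_Mapping.lookup (f * g) 0 = Poly_Mapping.lookup f 0 * Poly_Mapping.lookup g 0"
  for f g :: "'a word \<Rightarrow>\<^sub>0 complex"
proof -
  have *: "0 = l + q \<longleftrightarrow> q = 0 \<and> l = 0" for l q :: "'a word"
    by (cases l; cases q) (auto simp: zero_word_def plus_word_def)
  have "Poly_Mapping.lookup (f * g) 0 = (\<Sum>l. Poly_Mapping.lookup f l *
      (\<Sum>q. Poly_Mapping.lookup g q when 0 = l + q))"
    by (simp add: times_poly_mapping.rep_eq prod_fun_def)
  also have "\<dots> = (\<Sum>l. Poly_Mapping.lookup f l * Poly_Mapping.lookup g 0 when l = 0)"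
    by (rule Sum_any.cong) (auto simp: * when_def)
  finally show ?thesis
    by simp
qed

lemma lookup_gen_zero: "Poly_Mapping.lookup (gen x) 0 = 0"
  by (simp add: gen_def lookup_single zero_word_def)

lemma env_ideal_lookup_zero: "a \<in> env_ideal \<Longrightarrow> Poly_Mapping.lookup a 0 = 0"
  by (induction rule: env_ideal.induct)
    (simp_all add: lookup_times_zero_word lookup_add lookup_minus lookup_gen_zero)

lemma env_ideal_zero: "0 \<in> env_ideal"
  using env_ideal.mult_left[OF env_ideal.rel_add, of 0] by simp

lemma env_ideal_uminus: "a \<in> env_ideal \<Longrightarrow> - a \<in> env_ideal"
  using env_ideal.mult_left[of a "- 1"] by simp

definition env_rel :: "free_sl2 \<Rightarrow> free_sl2 \<Rightarrow> bool" where
  "env_rel a b \<longleftrightarrow> a - b \<in> env_ideal"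

lemma env_rel_equivp: "equivp env_rel"
proof (rule equivpI)
  show "reflp env_rel"
    by (simp add: reflp_def env_rel_def env_ideal_zero)
  show "symp env_rel"
    unfolding symp_def env_rel_def by (metis env_ideal_uminus minus_diff_eq)
  show "transp env_rel"
    unfolding transp_def env_rel_def
    by (metis add_diff_eq diff_add_cancel env_ideal.sum)
qed

quotient_type Usl2 = free_sl2 / env_rel
  by (rule env_rel_equivp)

instantiation Usl2 :: ring_1
begin

lift_definition zero_Usl2 :: Usl2 is 0 .

lift_definition one_Usl2 :: Usl2 is 1 .

lift_definition plus_Usl2 :: "Usl2 \<Rightarrow> Usl2 \<Rightarrow> Usl2" is "(+)"
  unfolding env_rel_def by (metis add_diff_add env_ideal.sum)

lift_definition uminus_Usl2 :: "Usl2 \<Rightarrow> Usl2" is uminus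
  unfolding env_rel_def by (metis env_ideal_uminus minus_diff_minus)

lift_definition minus_Usl2 :: "Usl2 \<Rightarrow> Usl2 \<Rightarrow> Usl2" is "(-)"
proof -
  fix a b c d :: free_sl2
  assume "env_rel a b" "env_rel c d"
  then have "(a - b) + - (c - d) \<in> env_ideal"
    unfolding env_rel_def by (intro env_ideal.sum env_ideal_uminus)
  then show "env_rel (a - c) (b - d)"
    unfolding env_rel_def by (simp add: algebra_simps)
qed

lift_definition times_Usl2 :: "Usl2 \<Rightarrow> Usl2 \<Rightarrow> Usl2" is "(*)"
proof -
  fix a b c d :: free_sl2
  assume "env_rel a b" "env_rel c d"
  then have "(a - b) * c + b * (c - d) \<in> env_ideal"
    unfolding env_rel_def by (intro env_ideal.sum env_ideal.mult_left env_ideal.mult_right)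
  then show "env_rel (a * c) (b * d)"
    unfolding env_rel_def by (simp add: algebra_simps)
qed

instance
proof
  have "(0 - 1 :: free_sl2) \<notin> env_ideal"
    using env_ideal_lookup_zero[of "0 - 1"] by (auto simp: lookup_minus lookup_one)
  then show "(0 :: Usl2) \<noteq> 1"
    by transfer (simp add: env_rel_def)
qed (transfer; simp add: env_rel_def env_ideal_zero algebra_simps)+

end

lift_definition scaleU :: "complex \<Rightarrow> Usl2 \<Rightarrow> Usl2" (infixr "*\<^sub>U" 75) is
  "\<lambda>c a. const_free c * a"
proof -
  fix c and a b :: free_sl2
  assume "env_rel a b"
  then have "const_free c * (a - b) \<in> env_ideal"
    unfolding env_rel_def by (rule env_ideal.mult_left)
  then show "env_rel (const_free c * a) (const_free c * b)"
    unfolding env_rel_def by (simp add: algebra_simps)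
qed

lift_definition incl :: "sl2 \<Rightarrow> Usl2" is gen .

definition casimir :: Usl2 where
  "casimir = incl sl2_X * incl sl2_Y + (1 / 2) *\<^sub>U (incl sl2_H)^2 + incl sl2_Y * incl sl2_X"

definition poly_casimir :: "complex poly \<Rightarrow> Usl2" where
  "poly_casimir z = (\<Sum>i\<le>degree z. coeff z i *\<^sub>U casimir ^ i)"

text \<open>A representation of dimension \<open>n\<close> is given on the space of column vectors of length \<open>n\<close>,
  so that its endomorphisms are the matrices of size \<open>n\<close>.\<close>

definition representation :: "nat \<Rightarrow> (Usl2 \<Rightarrow> complex mat) \<Rightarrow> bool" where
  "representation n \<pi> \<longleftrightarrow>
     (\<forall>u. \<pi> u \<in> carrier_mat n n) \<and>
     \<pi> 1 = 1\<^sub>m n \<and>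
     (\<forall>u v. \<pi> (u + v) = \<pi> u + \<pi> v) \<and>
     (\<forall>u v. \<pi> (u * v) = \<pi> u * \<pi> v) \<and>
     (\<forall>c u. \<pi> (c *\<^sub>U u) = c \<cdot>\<^sub>m \<pi> u)"

definition irreducible_rep :: "nat \<Rightarrow> (Usl2 \<Rightarrow> complex mat) \<Rightarrow> bool" where
  "irreducible_rep n \<pi> \<longleftrightarrow>
     representation n \<pi> \<and> n \<noteq> 0 \<and>
     (\<forall>W. VectorSpace.subspace class_ring W (module_vec TYPE(complex) n) \<and>
          (\<forall>u. \<forall>w\<in>W. \<pi> u *\<^sub>v w \<in> W) \<longrightarrow>
          W = {0\<^sub>v n} \<or> W = carrier_vec n)"

definition irreps :: "(nat \<times> (Usl2 \<Rightarrow> complex mat)) set" where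
  "irreps = {(n, \<pi>). irreducible_rep n \<pi>}"

text \<open>The irreducible representation of dimension \<open>n\<close> exists for \<open>n \<ge> 1\<close> and is unique up to
  equivalence only, hence the choice.\<close>

definition rho :: "nat \<Rightarrow> Usl2 \<Rightarrow> complex mat" where
  "rho n = (SOME \<pi>. irreducible_rep n \<pi>)"

definition casimir_value :: "nat \<Rightarrow> complex" where
  "casimir_value n = (of_nat n ^ 2 - 1) / 2"

definition Loc :: "(nat \<times> ('a \<Rightarrow> complex mat)) set \<Rightarrow> 'a set \<Rightarrow> 'a set" where
  "Loc \<C> P = {q. \<forall>(n, \<pi>)\<in>\<C>.
     \<pi> q \<in> LinearCombinations.module.span class_ring (module_mat TYPE(complex) n n) (\<pi> ` P)}"

definition Ref :: "(nat \<times> ('a \<Rightarrow> complex mat)) set \<Rightarrow> 'a set \<Rightarrow> 'a set" where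
  "Ref \<C> P = {q. \<forall>(n, \<pi>)\<in>\<C>. \<forall>v\<in>carrier_vec n.
     \<pi> q *\<^sub>v v \<in> LinearCombinations.module.span class_ring (module_vec TYPE(complex) n)
       ((\<lambda>p. \<pi> p *\<^sub>v v) ` P)}"

text \<open>Elements of the center are given as polynomials in the Casimir element; \<open>z 0\<close> is the
  multiplier of \<open>q\<close>, required to be nonzero as an element of the enveloping algebra.\<close>

definition central_combination ::
    "nat \<Rightarrow> (nat \<Rightarrow> Usl2) \<Rightarrow> Usl2 \<Rightarrow> (nat \<Rightarrow> complex poly) \<Rightarrow> bool" where
  "central_combination k p q z \<longleftrightarrow>
     poly_casimir (z 0) \<noteq> 0 \<and>
     poly_casimir (z 0) * q = (\<Sum>i = 1..k. poly_casimir (z i) * p i)"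

definition nonvanishing_where_nonzero :: "Usl2 \<Rightarrow> complex poly \<Rightarrow> bool" where
  "nonvanishing_where_nonzero q z \<longleftrightarrow>
     (\<forall>n\<ge>1. rho n q \<noteq> 0\<^sub>m n n \<longrightarrow> poly z (casimir_value n) \<noteq> 0)"

end

theory Submission
  imports Defs "Jordan_Normal_Form.Spectral_Radius"
begin

text \<open>An element of the enveloping algebra is determined by what it does on weight vectors, uniformly
  in the dimension. In the \<open>n\<close>-dimensional irreducible representation, a weight basis
  \<open>v\<^sub>0, \<dots>, v\<^sub>n\<^sub>-\<^sub>1\<close> can be chosen on which \<open>Y\<close> raises the index, \<open>X\<close> lowers it up to a nonzero factor,
  \<open>H\<close> acts by \<open>n - 1 - 2 j\<close> and the Casimir element \<open>C\<close> by \<open>c\<^sub>n\<close>. Every element is a combination of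
  \<open>Y\<^sup>e H\<^sup>b\<close> and \<open>X\<^sup>e H\<^sup>b\<close> with coefficients in \<open>\<complex>[C]\<close> (\<open>pbw_expansion\<close>), so that on \<open>v\<^sub>j\<close> its component of
  degree \<open>e\<close> is, up to a nonzero factor, a polynomial in the weight \<open>n - 1 - 2 j\<close> whose coefficients are the values
  at \<open>c\<^sub>n\<close> of these coefficients.

  A central relation whose leading coefficient does not vanish where \<open>q\<close> acts nontrivially yields membership in
  \<open>Loc\<close>, because \<open>C\<close> acts by the scalar \<open>c\<^sub>n\<close> and one may divide by \<open>z\<^sub>0(c\<^sub>n)\<close>; membership in \<open>Ref\<close> follows by
  applying the relations between matrices to vectors. The first step rests on the classification
  \<open>irreducible_rep_equivalent_std\<close>: an irreducible representation of dimension \<open>n\<close> is equivalent to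
  the standard one, hence sends \<open>C\<close> to \<open>c\<^sub>n\<close> and kills the same elements as any other of the same dimension.

  To obtain a central relation from membership in \<open>Ref\<close>, regard \<open>q, p\<^sub>1, \<dots>, p\<^sub>k\<close> as vectors of
  coefficients over the domain \<open>\<complex>[C]\<close>. If no relation exists, then a \<open>\<complex>[C]\<close>-linear functional annihilates all \<open>p\<^sub>i\<close> but not \<open>q\<close>
  (\<open>fraction_free_alternative\<close>). It takes on \<open>q\<close> a value in \<open>\<complex>[C]\<close> that does not vanish at \<open>c\<^sub>n\<close> for some
  large \<open>n\<close>, so no relation with constant coefficients holds between the coefficient vectors at \<open>C = c\<^sub>n\<close>. But
  membership in \<open>Ref\<close> provides such a relation: applied to a sum of widely spaced basis vectors \<open>v\<^sub>j\<close>, an element of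
  bounded degree keeps the contributions of the single \<open>v\<^sub>j\<close> apart, and if the result is zero, then each of these
  polynomials has more roots than its degree allows and must be zero (\<open>test_vec_detects_coefficients\<close>).

  The converses fail at a single small dimension. With \<open>c\<^sub>1 = 0\<close> and \<open>c\<^sub>2 = 3/2\<close>, the examples are
  \<open>1\<close> against \<open>1 + H, 1 + H - C\<close>; \<open>H\<close> against \<open>1, X, (C - c\<^sub>2) H\<close>; and \<open>1\<close> against \<open>C\<close>.\<close>

section \<open>The enveloping algebra and its Casimir element\<close>

lemma poly_mapping_single_add_induct [case_names single add]:
  fixes f :: "'a \<Rightarrow>\<^sub>0 complex"
  assumes single: "\<And>w c. P (Poly_Mapping.single w c)"
    and add: "\<And>f g. P f \<Longrightarrow> P g \<Longrightarrow> P (f + g)"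
  shows "P f"
proof (induction f rule: update_induct)
  case const
  then show ?case using single[of undefined 0] by simp
next
  case (update f a b)
  have "Poly_Mapping.update a b f = f + Poly_Mapping.single a b"
    using update by (intro poly_mapping_eqI)
      (auto simp: lookup_update lookup_add lookup_single in_keys_iff when_def)
  then show ?case using update single add by metis
qed

lemma const_free_commute: "f * const_free c = const_free c * f"
  unfolding const_free_def
  by (induction f rule: poly_mapping_single_add_induct) (simp_all add: mult_single algebra_simps)

lemma const_free_add: "const_free (c + d) = const_free c + const_free d"
  by (simp add: const_free_def single_add)

lemma const_free_mult: "const_free (c * d) = const_free c * const_free d"
  by (simp add: const_free_def mult_single)

lemma const_free_one: "const_free 1 = 1"
  by (simp add: const_free_def)

lemma scaleU_add_right: "c *\<^sub>U (u + v) = c *\<^sub>U u + c *\<^sub>U v"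
  by transfer (simp add: env_rel_def env_ideal_zero algebra_simps)

lemma scaleU_add_left: "(c + d) *\<^sub>U u = c *\<^sub>U u + d *\<^sub>U u"
  by transfer (simp add: env_rel_def env_ideal_zero algebra_simps const_free_add)

lemma scaleU_scaleU: "c *\<^sub>U d *\<^sub>U u = (c * d) *\<^sub>U u"
  by transfer (simp add: env_rel_def env_ideal_zero algebra_simps const_free_mult)

lemma scaleU_one: "1 *\<^sub>U u = u"
  by transfer (simp add: env_rel_def env_ideal_zero const_free_one)

lemma scaleU_mult_left: "(c *\<^sub>U u) * v = c *\<^sub>U (u * v)"
  by transfer (simp add: env_rel_def env_ideal_zero algebra_simps)

lemma scaleU_mult_right: "u * (c *\<^sub>U v) = c *\<^sub>U (u * v)"
proof transfer
  fix c and u v :: free_sl2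
  have "u * (const_free c * v) = const_free c * (u * v)"
    by (metis const_free_commute mult.assoc)
  then show "env_rel (u * (const_free c * v)) (const_free c * (u * v))"
    by (simp add: env_rel_def env_ideal_zero)
qed

lemma module_scaleU: "module scaleU"
  by unfold_locales (simp_all add: scaleU_add_right scaleU_add_left scaleU_scaleU scaleU_one)

interpretation scaleU: module scaleU
  by (rule module_scaleU)

lemma sl2_coordinates:
  "x = sl2_add (sl2_scale (Rep_sl2 x $$ (0, 0)) sl2_H)
     (sl2_add (sl2_scale (Rep_sl2 x $$ (0, 1)) sl2_X) (sl2_scale (Rep_sl2 x $$ (1, 0)) sl2_Y))"
proof -
  have *: "Rep_sl2 x $$ (1, 1) = - (Rep_sl2 x $$ (0, 0))" "dim_row (Rep_sl2 x) = 2" "dim_col (Rep_sl2 x) = 2"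
    using Rep_sl2[of x] by (auto simp: sum_two add_eq_0_iff)
  show ?thesis
    using * unfolding Rep_sl2_inject[symmetric]
    by (auto simp: sl2_add.rep_eq sl2_scale.rep_eq sl2_H.rep_eq sl2_X.rep_eq sl2_Y.rep_eq
        mat_eq_iff less_2_cases_iff)
qed

lemma incl_add: "incl (sl2_add x y) = incl x + incl y"
  by transfer (simp add: env_rel_def env_ideal.rel_add)

lemma incl_scale: "incl (sl2_scale c x) = c *\<^sub>U incl x"
  by transfer (simp add: env_rel_def env_ideal.rel_scale)

lemma incl_bracket: "incl (sl2_bracket x y) = incl x * incl y - incl y * incl x"
proof transfer
  fix x y
  show "env_rel (gen (sl2_bracket x y)) (gen x * gen y - gen y * gen x)"
    using env_ideal_uminus[OF env_ideal.rel_bracket[of x y]] by (simp add: env_rel_def)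
qed

abbreviation "UX \<equiv> incl sl2_X"
abbreviation "UY \<equiv> incl sl2_Y"
abbreviation "UH \<equiv> incl sl2_H"

lemma sl2_brackets:
  "sl2_bracket sl2_H sl2_X = sl2_scale 2 sl2_X"
  "sl2_bracket sl2_H sl2_Y = sl2_scale (- 2) sl2_Y"
  "sl2_bracket sl2_X sl2_Y = sl2_H"
  by (auto simp: Rep_sl2_inject[symmetric] sl2_bracket.rep_eq sl2_scale.rep_eq sl2_H.rep_eq
      sl2_X.rep_eq sl2_Y.rep_eq mat_eq_iff less_2_cases_iff scalar_prod_def
      atLeast0LessThan sum_two)

lemma U_relations:
  "UH * UX = UX * UH + 2 *\<^sub>U UX"
  "UH * UY = UY * UH - 2 *\<^sub>U UY"
  "UX * UY = UY * UX + UH"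
  using incl_bracket[of sl2_H sl2_X] incl_bracket[of sl2_H sl2_Y] incl_bracket[of sl2_X sl2_Y]
  by (simp_all add: sl2_brackets incl_scale scaleU.scale_minus_left algebra_simps)

text \<open>Words in arbitrary letters of \<open>sl2\<close> span the free algebra, and each letter is a linear combination of
  the three basis elements; it therefore suffices to follow left multiplication by \<open>X\<close>, \<open>Y\<close> and \<open>H\<close>.\<close>

lemma Usl2_induct [case_names scalar add scale X Y H]:
  assumes one: "P 1"
    and add: "\<And>u v. P u \<Longrightarrow> P v \<Longrightarrow> P (u + v)"
    and scale: "\<And>c u. P u \<Longrightarrow> P (c *\<^sub>U u)"
    and X: "\<And>u. P u \<Longrightarrow> P (UX * u)"
    and Y: "\<And>u. P u \<Longrightarrow> P (UY * u)"
    and H: "\<And>u. P u \<Longrightarrow> P (UH * u)"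
  shows "P u"
proof -
  have word: "P (abs_Usl2 (Poly_Mapping.single (Word xs) 1))" for xs
  proof (induction xs)
    case Nil
    then show ?case using one by (simp add: one_Usl2_def zero_word_def flip: single_one)
  next
    case (Cons x xs)
    let ?w = "abs_Usl2 (Poly_Mapping.single (Word xs) 1)"
    have "abs_Usl2 (Poly_Mapping.single (Word (x # xs)) 1) = incl x * ?w"
      by (simp add: incl_def gen_def times_Usl2.abs_eq mult_single plus_word_def)
    also have "\<dots> = Rep_sl2 x $$ (0, 0) *\<^sub>U (UH * ?w) +
        (Rep_sl2 x $$ (0, 1) *\<^sub>U (UX * ?w) + Rep_sl2 x $$ (1, 0) *\<^sub>U (UY * ?w))"
      by (subst sl2_coordinates[of x])
        (simp add: incl_add incl_scale scaleU_mult_left distrib_right)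
    finally show ?case using Cons add scale X Y H by simp
  qed
  have "P (abs_Usl2 f)" for f
  proof (induction f rule: poly_mapping_single_add_induct)
    case (single w c)
    have "abs_Usl2 (Poly_Mapping.single w c) = c *\<^sub>U abs_Usl2 (Poly_Mapping.single w 1)"
      by (simp add: scaleU.abs_eq const_free_def mult_single)
    moreover have "P (abs_Usl2 (Poly_Mapping.single w 1))"
      using word by (cases w) simp
    ultimately show ?case using scale by simp
  next
    case (add f g)
    then show ?case using assms(2) by (simp flip: plus_Usl2.abs_eq)
  qed
  then show ?thesis by (metis Quotient_abs_rep Quotient_Usl2)
qed

text \<open>Eliminating either \<open>XY\<close> or \<open>YX\<close> with the help of \<open>[X, Y] = H\<close> gives two forms of the Casimir element.
  Using one on the left and the other on the right of a generator makes the cubic terms agree in the proofs of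
  centrality below.\<close>

lemma casimir_eqs:
  "casimir = 2 *\<^sub>U (UY * UX) + UH + (1 / 2) *\<^sub>U (UH * UH)"
  "casimir = 2 *\<^sub>U (UX * UY) - UH + (1 / 2) *\<^sub>U (UH * UH)"
proof -
  have two: "2 *\<^sub>U u = u + u" for u
    using scaleU_add_left[of 1 1 u] by (simp add: scaleU_one)
  show "casimir = 2 *\<^sub>U (UY * UX) + UH + (1 / 2) *\<^sub>U (UH * UH)"
    by (simp add: casimir_def two U_relations(3) power2_eq_square algebra_simps)
  then show "casimir = 2 *\<^sub>U (UX * UY) - UH + (1 / 2) *\<^sub>U (UH * UH)"
    by (simp add: two U_relations(3) algebra_simps)
qed

lemma UH_UH_UX: "UH * (UH * UX) = UX * (UH * UH) + 4 *\<^sub>U (UX * UH) + 4 *\<^sub>U UX"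
proof -
  have "UH * (UH * UX) = (UH * UX) * UH + 2 *\<^sub>U (UH * UX)"
    by (subst U_relations(1)) (simp add: distrib_left scaleU_mult_right mult.assoc)
  also have "\<dots> = UX * (UH * UH) + (2 *\<^sub>U (UX * UH) + 2 *\<^sub>U (UX * UH)) + 4 *\<^sub>U UX"
    by (simp add: U_relations(1) scaleU_add_right scaleU_mult_left mult.assoc distrib_right scaleU_scaleU)
  finally show ?thesis by (simp flip: scaleU_add_left)
qed

lemma UH_UH_UY: "UH * (UH * UY) = UY * (UH * UH) - 4 *\<^sub>U (UY * UH) + 4 *\<^sub>U UY"
proof -
  have "UH * (UH * UY) = (UH * UY) * UH - 2 *\<^sub>U (UH * UY)"
    by (subst U_relations(2)) (simp add: right_diff_distrib scaleU_mult_right mult.assoc)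
  also have "\<dots> = UY * (UH * UH) - (2 *\<^sub>U (UY * UH) + 2 *\<^sub>U (UY * UH)) + 4 *\<^sub>U UY"
    by (simp add: U_relations(2) scaleU.scale_right_diff_distrib scaleU_mult_left mult.assoc
        left_diff_distrib scaleU_scaleU)
  finally show ?thesis by (simp flip: scaleU_add_left)
qed

lemma casimir_commute_UX: "casimir * UX = UX * casimir"
proof -
  have "casimir * UX = 2 *\<^sub>U (UX * (UY * UX)) - UH * UX + (1 / 2) *\<^sub>U (UH * (UH * UX))"
    by (simp add: casimir_eqs(2) algebra_simps scaleU_mult_left)
  also have "\<dots> = 2 *\<^sub>U (UX * (UY * UX)) + UX * UH + (1 / 2) *\<^sub>U (UX * (UH * UH)) +
      (2 *\<^sub>U (UX * UH) - UX * UH - UX * UH)"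
    by (subst UH_UH_UX, subst U_relations(1)) (simp add: scaleU_add_right scaleU_scaleU)
  also have "2 *\<^sub>U (UX * UH) - UX * UH - UX * UH = 0"
    using scaleU_add_left[of 1 1 "UX * UH"] by (simp add: scaleU_one)
  also have "2 *\<^sub>U (UX * (UY * UX)) + UX * UH + (1 / 2) *\<^sub>U (UX * (UH * UH)) + 0 = UX * casimir"
    by (simp add: casimir_eqs(1) algebra_simps scaleU_mult_right)
  finally show ?thesis .
qed

lemma casimir_commute_UY: "casimir * UY = UY * casimir"
proof -
  have "casimir * UY = 2 *\<^sub>U (UY * (UX * UY)) + UH * UY + (1 / 2) *\<^sub>U (UH * (UH * UY))"
    by (simp add: casimir_eqs(1) algebra_simps scaleU_mult_left)
  also have "\<dots> = 2 *\<^sub>U (UY * (UX * UY)) - UY * UH + (1 / 2) *\<^sub>U (UY * (UH * UH)) -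
      (2 *\<^sub>U (UY * UH) - UY * UH - UY * UH)"
    by (subst UH_UH_UY, subst U_relations(2)) (simp add: scaleU_add_right scaleU.scale_right_diff_distrib scaleU_scaleU)
  also have "2 *\<^sub>U (UY * UH) - UY * UH - UY * UH = 0"
    using scaleU_add_left[of 1 1 "UY * UH"] by (simp add: scaleU_one)
  also have "2 *\<^sub>U (UY * (UX * UY)) - UY * UH + (1 / 2) *\<^sub>U (UY * (UH * UH)) - 0 = UY * casimir"
    by (simp add: casimir_eqs(2) algebra_simps scaleU_mult_right)
  finally show ?thesis .
qed

lemma casimir_commute_UH: "casimir * UH = UH * casimir"
proof -
  have "UH * (UY * UX) = UY * UX * UH"
  proof -
    have "UH * (UY * UX) = UY * (UH * UX) - 2 *\<^sub>U (UY * UX)"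
      by (simp add: U_relations(2) left_diff_distrib scaleU_mult_left flip: mult.assoc)
    then show ?thesis
      by (simp add: U_relations(1) distrib_left scaleU_mult_right mult.assoc)
  qed
  then show ?thesis
    by (simp add: casimir_eqs(1) algebra_simps scaleU_mult_left scaleU_mult_right)
qed

lemma casimir_commute: "casimir * u = u * casimir"
proof (induction u rule: Usl2_induct)
  case (add u v)
  then show ?case by (simp add: algebra_simps)
next
  case (scale c u)
  then show ?case by (simp add: scaleU_mult_left scaleU_mult_right)
qed (simp_all, (metis casimir_commute_UX casimir_commute_UY casimir_commute_UH mult.assoc)+)

text \<open>Summing up to any bound above the degree allows polynomials of different degrees to be compared
  coefficientwise, which makes \<open>poly_casimir\<close> a ring homomorphism into the centre.\<close>

lemma poly_casimir_altdef:
  "degree z \<le> N \<Longrightarrow> poly_casimir z = (\<Sum>i\<le>N. coeff z i *\<^sub>U casimir ^ i)"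
  unfolding poly_casimir_def
  by (rule sum.mono_neutral_left) (auto simp: coeff_eq_0)

lemma poly_casimir_0 [simp]: "poly_casimir 0 = 0"
  by (simp add: poly_casimir_def)

lemma poly_casimir_pCons: "poly_casimir (pCons a z) = a *\<^sub>U 1 + casimir * poly_casimir z"
proof -
  have "poly_casimir (pCons a z) = (\<Sum>i\<le>Suc (degree z). coeff (pCons a z) i *\<^sub>U casimir ^ i)"
    by (rule poly_casimir_altdef) (simp add: degree_pCons_le)
  then show ?thesis
    by (simp add: sum.atMost_Suc_shift poly_casimir_def sum_distrib_left scaleU_mult_right
        del: sum.atMost_Suc)
qed

lemma poly_casimir_add: "poly_casimir (z + w) = poly_casimir z + poly_casimir w"
  by (simp add: poly_casimir_altdef[of _ "max (degree z) (degree w)"] degree_add_le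
      scaleU_add_left sum.distrib)

lemma poly_casimir_smult: "poly_casimir (Polynomial.smult c z) = c *\<^sub>U poly_casimir z"
  by (simp add: poly_casimir_altdef[of _ "degree z"] degree_smult_le scaleU_scaleU
      scaleU.scale_sum_right)

lemma poly_casimir_mult: "poly_casimir (z * w) = poly_casimir z * poly_casimir w"
  by (induction z)
    (simp_all add: mult_pCons_left poly_casimir_add poly_casimir_smult poly_casimir_pCons
      scaleU_mult_left algebra_simps)

lemma poly_casimir_sum: "poly_casimir (sum f A) = (\<Sum>x\<in>A. poly_casimir (f x))"
  by (induction A rule: infinite_finite_induct) (simp_all add: poly_casimir_add)

lemma poly_casimir_const: "poly_casimir [:c:] = c *\<^sub>U 1"
  by (simp add: poly_casimir_pCons)

lemma poly_casimir_one: "poly_casimir 1 = 1"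
  by (simp add: one_pCons poly_casimir_const scaleU_one)

lemma poly_casimir_commute: "poly_casimir z * u = u * poly_casimir z"
proof (induction z)
  case (pCons a z)
  have "casimir * poly_casimir z * u = u * (casimir * poly_casimir z)"
    by (metis casimir_commute mult.assoc pCons(2))
  then show ?case
    by (simp add: poly_casimir_pCons algebra_simps scaleU_mult_left scaleU_mult_right)
qed simp

lemma poly_casimir_left_commute: "u * (poly_casimir z * v) = poly_casimir z * (u * v)"
  by (metis poly_casimir_commute mult.assoc)

section \<open>A spanning set over the polynomials in the Casimir element\<close>

text \<open>Multiplication by \<open>weight_op e\<close> changes the index of a weight vector by \<open>e\<close>, so that the sign of \<open>e\<close> selects
  powers of \<open>Y\<close> or of \<open>X\<close>.\<close>

definition weight_op :: "int \<Rightarrow> Usl2" where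
  "weight_op e = (if e \<ge> 0 then UY ^ nat e else UX ^ nat (- e))"

definition pbw :: "int \<times> nat \<Rightarrow> Usl2" where
  "pbw = (\<lambda>(e, b). weight_op e * UH ^ b)"

lemma UH_weight_op: "UH * weight_op e = weight_op e * UH - (2 * of_int e) *\<^sub>U weight_op e"
proof -
  have Y: "UH * UY ^ k = UY ^ k * UH - (2 * of_nat k) *\<^sub>U UY ^ k" for k
  proof (induction k)
    case (Suc k)
    have "UH * UY ^ Suc k = (UH * UY) * UY ^ k"
      by (simp add: mult.assoc)
    also have "\<dots> = UY * (UH * UY ^ k) - 2 *\<^sub>U (UY * UY ^ k)"
      by (simp add: U_relations(2) left_diff_distrib mult.assoc scaleU_mult_left)
    also have "\<dots> = UY ^ Suc k * UH - ((2 * of_nat k) *\<^sub>U UY ^ Suc k + 2 *\<^sub>U UY ^ Suc k)"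
      by (simp add: Suc right_diff_distrib mult.assoc scaleU_mult_right)
    finally show ?case by (simp add: scaleU_add_left algebra_simps)
  qed simp
  have X: "UH * UX ^ k = UX ^ k * UH + (2 * of_nat k) *\<^sub>U UX ^ k" for k
  proof (induction k)
    case (Suc k)
    have "UH * UX ^ Suc k = (UH * UX) * UX ^ k"
      by (simp add: mult.assoc)
    also have "\<dots> = UX * (UH * UX ^ k) + 2 *\<^sub>U (UX * UX ^ k)"
      by (simp add: U_relations(1) distrib_right mult.assoc scaleU_mult_left)
    also have "\<dots> = UX ^ Suc k * UH + ((2 * of_nat k) *\<^sub>U UX ^ Suc k + 2 *\<^sub>U UX ^ Suc k)"
      by (simp add: Suc distrib_left mult.assoc scaleU_mult_right)
    finally show ?case by (simp add: scaleU_add_left algebra_simps)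
  qed simp
  show ?thesis
    using Y[of "nat e"] X[of "nat (- e)"] by (auto simp: weight_op_def)
qed

text \<open>The span is taken over the polynomials in the Casimir element. Products of \<open>X\<close> and \<open>Y\<close> need not appear in
  the generators, because they are polynomials in \<open>C\<close> and \<open>H\<close>.\<close>

inductive_set pbw_span :: "Usl2 set" where
  gen: "poly_casimir z * pbw s \<in> pbw_span"
| sum: "u \<in> pbw_span \<Longrightarrow> v \<in> pbw_span \<Longrightarrow> u + v \<in> pbw_span"

lemma pbw_span_central:
  assumes "u \<in> pbw_span"
  shows "poly_casimir w * u \<in> pbw_span"
  using assms
proof (induction)
  case (gen z s)
  then show ?case using pbw_span.gen[of "w * z" s] by (simp add: poly_casimir_mult mult.assoc)
qed (simp add: distrib_left pbw_span.sum)

lemma pbw_span_scale: "u \<in> pbw_span \<Longrightarrow> c *\<^sub>U u \<in> pbw_span"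
  using pbw_span_central[of u "[:c:]"] by (simp add: poly_casimir_const scaleU_mult_left)

lemma pbw_span_diff: "u \<in> pbw_span \<Longrightarrow> v \<in> pbw_span \<Longrightarrow> u - v \<in> pbw_span"
  using pbw_span.sum[of u "(- 1) *\<^sub>U v"] pbw_span_scale[of v "- 1"]
  by (simp add: scaleU.scale_minus_left scaleU_one)

lemma pbw_span_casimir: "u \<in> pbw_span \<Longrightarrow> casimir * u \<in> pbw_span"
  using pbw_span_central[of u "[:0, 1:]"] by (simp add: poly_casimir_pCons scaleU_one)

lemma pbw_span_pbw: "pbw s \<in> pbw_span"
  using pbw_span.gen[of 1 s] by (simp add: poly_casimir_one)

lemma pbw_span_weight_op: "weight_op e \<in> pbw_span"
  using pbw_span_pbw[of "(e, 0)"] by (simp add: pbw_def)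

lemma pbw_span_right_UH_power:
  assumes "u \<in> pbw_span"
  shows "u * UH ^ k \<in> pbw_span"
  using assms
proof (induction)
  case (gen z s)
  then show ?case using pbw_span.gen[of z "(fst s, snd s + k)"]
    by (simp add: pbw_def case_prod_unfold power_add mult.assoc)
qed (simp add: distrib_right pbw_span.sum)

text \<open>Since polynomials in \<open>C\<close> are central and powers of \<open>H\<close> stand on the right, only the products with the
  \<open>weight_op e\<close> matter.\<close>

lemma pbw_span_left:
  assumes "\<And>e. g * weight_op e \<in> pbw_span" and "u \<in> pbw_span"
  shows "g * u \<in> pbw_span"
  using assms(2)
proof (induction)
  case (gen z s)
  have "poly_casimir z * (g * weight_op (fst s) * UH ^ snd s) \<in> pbw_span"
    by (intro pbw_span_central pbw_span_right_UH_power assms(1))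
  then show ?case
    by (simp add: pbw_def case_prod_unfold poly_casimir_left_commute mult.assoc)
qed (simp add: distrib_left pbw_span.sum)

lemma pbw_span_left_UH: "u \<in> pbw_span \<Longrightarrow> UH * u \<in> pbw_span"
proof (rule pbw_span_left)
  fix e
  show "UH * weight_op e \<in> pbw_span"
    unfolding UH_weight_op
    using pbw_span_pbw[of "(e, 1)"]
    by (intro pbw_span_diff pbw_span_scale pbw_span_weight_op) (simp add: pbw_def)
qed

text \<open>These identities let a generator that meets one of the opposite kind be absorbed into \<open>\<complex>[C]\<close> and powers
  of \<open>H\<close>.\<close>

lemma UX_UY_eq: "UX * UY = (1 / 2) *\<^sub>U (casimir + UH - (1 / 2) *\<^sub>U (UH * UH))"
  and UY_UX_eq: "UY * UX = (1 / 2) *\<^sub>U (casimir - UH - (1 / 2) *\<^sub>U (UH * UH))"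
proof -
  have "casimir + UH - (1 / 2) *\<^sub>U (UH * UH) = 2 *\<^sub>U (UX * UY)"
    by (simp add: casimir_eqs(2))
  then show "UX * UY = (1 / 2) *\<^sub>U (casimir + UH - (1 / 2) *\<^sub>U (UH * UH))"
    by (simp add: scaleU_scaleU scaleU_one)
  have "casimir - UH - (1 / 2) *\<^sub>U (UH * UH) = 2 *\<^sub>U (UY * UX)"
    by (simp add: casimir_eqs(1))
  then show "UY * UX = (1 / 2) *\<^sub>U (casimir - UH - (1 / 2) *\<^sub>U (UH * UH))"
    by (simp add: scaleU_scaleU scaleU_one)
qed

lemma pbw_span_left_UY: "u \<in> pbw_span \<Longrightarrow> UY * u \<in> pbw_span"
proof (rule pbw_span_left)
  fix e
  show "UY * weight_op e \<in> pbw_span"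
  proof (cases "e \<ge> 0")
    case True
    then have "UY * weight_op e = weight_op (e + 1)"
      by (simp add: weight_op_def nat_add_distrib)
    then show ?thesis by (simp add: pbw_span_weight_op)
  next
    case False
    define k where "k = nat (- e - 1)"
    have e: "weight_op e = UX * weight_op (- int k)"
    proof -
      have "nat (- e) = Suc k" using False by (simp add: k_def)
      then show ?thesis using False by (simp add: weight_op_def)
    qed
    have "UY * weight_op e = (UY * UX) * weight_op (- int k)"
      by (simp add: e mult.assoc)
    also have "\<dots> \<in> pbw_span"
      unfolding UY_UX_eq
      by (simp add: scaleU_mult_left left_diff_distrib mult.assoc pbw_span_scale pbw_span_diff
          pbw_span_casimir pbw_span_left_UH pbw_span_weight_op)
    finally show ?thesis .
  qed
qed

lemma pbw_span_left_UX: "u \<in> pbw_span \<Longrightarrow> UX * u \<in> pbw_span"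
proof (rule pbw_span_left)
  fix e
  show "UX * weight_op e \<in> pbw_span"
  proof (cases "e \<le> 0")
    case True
    then have "UX * weight_op e = weight_op (e - 1)"
      using power_Suc[of UX "nat (- e)"] by (auto simp: weight_op_def Suc_nat_eq_nat_zadd1)
    then show ?thesis by (simp add: pbw_span_weight_op)
  next
    case False
    define k where "k = nat (e - 1)"
    have e: "weight_op e = UY * weight_op (int k)"
    proof -
      have "nat e = Suc k" using False by (simp add: k_def)
      then show ?thesis using False by (simp add: weight_op_def)
    qed
    have "UX * weight_op e = (UX * UY) * weight_op (int k)"
      by (simp add: e mult.assoc)
    also have "\<dots> \<in> pbw_span"
      unfolding UX_UY_eq
      by (simp add: scaleU_mult_left left_diff_distrib distrib_right mult.assoc pbw_span_scale
          pbw_span_diff pbw_span.sum pbw_span_casimir pbw_span_left_UH pbw_span_weight_op)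
    finally show ?thesis .
  qed
qed

lemma pbw_span_UNIV: "u \<in> pbw_span"
proof (induction u rule: Usl2_induct)
  case scalar
  then show ?case using pbw_span_pbw[of "(0, 0)"] by (simp add: pbw_def weight_op_def)
qed (simp_all add: pbw_span.sum pbw_span_scale pbw_span_left_UX pbw_span_left_UY pbw_span_left_UH)

text \<open>All pairs of a degree \<open>e\<close> and an exponent \<open>b\<close> of \<open>H\<close> bounded by the same \<open>N\<close>. A common bound allows finitely many
  elements to be expanded over the same index set.\<close>

definition box :: "nat \<Rightarrow> (int \<times> nat) set" where
  "box N = {- int N..int N} \<times> {..N}"

lemma finite_box [simp]: "finite (box N)"
  by (simp add: box_def)

text \<open>The coefficients vanish outside a finite set, so one family of coefficients serves for all larger boxes.\<close>

lemma pbw_expansion: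
  "\<exists>N F. \<forall>M\<ge>N. u = (\<Sum>s\<in>box M. poly_casimir (F s) * pbw s)"
  using pbw_span_UNIV[of u]
proof (induction)
  case (gen z s)
  show ?case
  proof (intro exI allI impI)
    fix M assume "max (nat \<bar>fst s\<bar>) (snd s) \<le> M"
    then have "s \<in> box M"
      by (cases s) (auto simp: box_def)
    then show "poly_casimir z * pbw s =
        (\<Sum>t\<in>box M. poly_casimir (if t = s then z else 0) * pbw t)"
      by (simp add: if_distrib[of poly_casimir] if_distrib[of "\<lambda>x. x * _"] cong: if_cong)
  qed
next
  case (sum u v)
  obtain N F where 1: "\<And>M. M \<ge> N \<Longrightarrow> u = (\<Sum>s\<in>box M. poly_casimir (F s) * pbw s)"
    using sum by blast
  obtain N' F' where 2: "\<And>M. M \<ge> N' \<Longrightarrow> v = (\<Sum>s\<in>box M. poly_casimir (F' s) * pbw s)"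
    using sum by blast
  show ?case
  proof (intro exI allI impI)
    fix M assume M: "max N N' \<le> M"
    show "u + v = (\<Sum>s\<in>box M. poly_casimir (F s + F' s) * pbw s)"
      using M 1[of M] 2[of M] by (simp add: poly_casimir_add distrib_right sum.distrib)
  qed
qed

section \<open>The standard representations\<close>

text \<open>The matrix of \<open>a H + b X + c Y\<close> in the basis \<open>v\<^sub>j = Y\<^sup>j v\<^sub>0\<close>. The superdiagonal factor
  \<open>(i + 1) (n - 1 - i)\<close> is the coefficient of \<open>v\<^sub>i\<close> in \<open>X v\<^sub>i\<^sub>+\<^sub>1\<close>; the three summands of the entry have disjoint
  supports, which makes row sums easy to compute.\<close>

definition std_sl2 :: "nat \<Rightarrow> sl2 \<Rightarrow> complex mat" where
  "std_sl2 n x = mat n n (\<lambda>(i, j).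
     (if j = i then Rep_sl2 x $$ (0, 0) * (of_nat n - 1 - 2 * of_nat i) else 0) +
     (if j = Suc i then Rep_sl2 x $$ (0, 1) * ((of_nat i + 1) * (of_nat n - 1 - of_nat i)) else 0) +
     (if i = Suc j then Rep_sl2 x $$ (1, 0) else 0))"

lemma std_sl2_carrier: "std_sl2 n x \<in> carrier_mat n n"
  by (simp add: std_sl2_def)

lemma dim_std_sl2 [simp]: "dim_row (std_sl2 n x) = n" "dim_col (std_sl2 n x) = n"
  by (simp_all add: std_sl2_def)

lemma std_sl2_mult_index:
  assumes B: "B \<in> carrier_mat n m" and ik: "i < n" "k < m"
  shows "(std_sl2 n x * B) $$ (i, k) =
    Rep_sl2 x $$ (0, 0) * (of_nat n - 1 - 2 * of_nat i) * B $$ (i, k) +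
    (if Suc i < n then Rep_sl2 x $$ (0, 1) * ((of_nat i + 1) * (of_nat n - 1 - of_nat i)) * B $$ (Suc i, k) else 0) +
    (if i = 0 then 0 else Rep_sl2 x $$ (1, 0) * B $$ (i - 1, k))"
proof -
  let ?a = "Rep_sl2 x $$ (0, 0) * (of_nat n - 1 - 2 * of_nat i)"
  let ?b = "Rep_sl2 x $$ (0, 1) * ((of_nat i + 1) * (of_nat n - 1 - of_nat i))"
  let ?c = "Rep_sl2 x $$ (1, 0)"
  have eq: "i = Suc j \<longleftrightarrow> i \<noteq> 0 \<and> j = i - 1" for j
    by auto
  have "(std_sl2 n x * B) $$ (i, k) = (\<Sum>j<n. std_sl2 n x $$ (i, j) * B $$ (j, k))"
    using assms by (simp add: scalar_prod_def atLeast0LessThan)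
  also have "\<dots> = (\<Sum>j<n. (if j = i then ?a * B $$ (j, k) else 0) +
      (if j = Suc i then ?b * B $$ (j, k) else 0) + (if i = Suc j then ?c * B $$ (j, k) else 0))"
    using ik by (intro sum.cong) (auto simp: std_sl2_def distrib_right)
  also have "\<dots> = ?a * B $$ (i, k) + (if Suc i < n then ?b * B $$ (Suc i, k) else 0) +
      (if i = 0 then 0 else ?c * B $$ (i - 1, k))"
    using ik by (cases i) (simp_all add: sum.distrib)
  finally show ?thesis .
qed

lemma std_sl2_add: "std_sl2 n (sl2_add x y) = std_sl2 n x + std_sl2 n y"
  using Rep_sl2[of x] Rep_sl2[of y] by (auto simp: std_sl2_def sl2_add.rep_eq mat_eq_iff algebra_simps)

lemma std_sl2_scale: "std_sl2 n (sl2_scale c x) = c \<cdot>\<^sub>m std_sl2 n x"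
  using Rep_sl2[of x] by (auto simp: std_sl2_def sl2_scale.rep_eq mat_eq_iff algebra_simps)

lemma sl2_bracket_entries:
  "Rep_sl2 (sl2_bracket x y) $$ (0, 0) =
     Rep_sl2 x $$ (0, 1) * Rep_sl2 y $$ (1, 0) - Rep_sl2 y $$ (0, 1) * Rep_sl2 x $$ (1, 0)"
  "Rep_sl2 (sl2_bracket x y) $$ (0, 1) =
     2 * (Rep_sl2 x $$ (0, 0) * Rep_sl2 y $$ (0, 1) - Rep_sl2 y $$ (0, 0) * Rep_sl2 x $$ (0, 1))"
  "Rep_sl2 (sl2_bracket x y) $$ (1, 0) =
     2 * (Rep_sl2 x $$ (1, 0) * Rep_sl2 y $$ (0, 0) - Rep_sl2 y $$ (1, 0) * Rep_sl2 x $$ (0, 0))"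
proof -
  have tr: "Rep_sl2 z $$ (1, 1) = - (Rep_sl2 z $$ (0, 0))" "dim_row (Rep_sl2 z) = 2" "dim_col (Rep_sl2 z) = 2" for z
    using Rep_sl2[of z] by (auto simp: sum_two add_eq_0_iff)
  show "Rep_sl2 (sl2_bracket x y) $$ (0, 0) =
     Rep_sl2 x $$ (0, 1) * Rep_sl2 y $$ (1, 0) - Rep_sl2 y $$ (0, 1) * Rep_sl2 x $$ (1, 0)"
    "Rep_sl2 (sl2_bracket x y) $$ (0, 1) =
     2 * (Rep_sl2 x $$ (0, 0) * Rep_sl2 y $$ (0, 1) - Rep_sl2 y $$ (0, 0) * Rep_sl2 x $$ (0, 1))"
    "Rep_sl2 (sl2_bracket x y) $$ (1, 0) =
     2 * (Rep_sl2 x $$ (1, 0) * Rep_sl2 y $$ (0, 0) - Rep_sl2 y $$ (1, 0) * Rep_sl2 x $$ (0, 0))"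
    using tr(2,3)[of x] tr(2,3)[of y]
    by (simp_all add: sl2_bracket.rep_eq scalar_prod_def atLeast0LessThan sum_two tr(1)[unfolded One_nat_def] algebra_simps)
qed

text \<open>A product of two tridiagonal matrices has at most five nonzero diagonals, and the identity is checked on
  each of them. At the lower right corner the term with row index \<open>i + 1\<close> is missing, which does no harm since its
  factor \<open>n - 1 - i\<close> would be zero there.\<close>

lemma std_sl2_bracket:
  "std_sl2 n (sl2_bracket x y) = std_sl2 n x * std_sl2 n y - std_sl2 n y * std_sl2 n x"
proof (rule eq_matI)
  fix i j
  assume "i < dim_row (std_sl2 n x * std_sl2 n y - std_sl2 n y * std_sl2 n x)"
    "j < dim_col (std_sl2 n x * std_sl2 n y - std_sl2 n y * std_sl2 n x)"
  then have ij: "i < n" "j < n"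
    by auto
  define a b c where "a = Rep_sl2 x $$ (0, 0)" and "b = Rep_sl2 x $$ (0, 1)" and "c = Rep_sl2 x $$ (1, 0)"
  define a' b' c' where "a' = Rep_sl2 y $$ (0, 0)" and "b' = Rep_sl2 y $$ (0, 1)" and "c' = Rep_sl2 y $$ (1, 0)"
  note defs = a_def[symmetric] b_def[symmetric] c_def[symmetric]
    a'_def[symmetric] b'_def[symmetric] c'_def[symmetric]
  define E where "E = (\<lambda>\<alpha> \<beta> \<gamma> k l.
     (if l = k then \<alpha> * (of_nat n - 1 - 2 * of_nat k) else 0) +
     (if l = Suc k then \<beta> * ((of_nat k + 1) * (of_nat n - 1 - of_nat k)) else 0) +
     (if k = Suc l then \<gamma> else (0 :: complex)))"
  have E: "std_sl2 n z $$ (k, l) = E (Rep_sl2 z $$ (0, 0)) (Rep_sl2 z $$ (0, 1)) (Rep_sl2 z $$ (1, 0)) k l"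
    if "k < n" "l < n" for z k l
    using that by (simp add: std_sl2_def E_def)
  have "(std_sl2 n x * std_sl2 n y - std_sl2 n y * std_sl2 n x) $$ (i, j) =
      (std_sl2 n x * std_sl2 n y) $$ (i, j) - (std_sl2 n y * std_sl2 n x) $$ (i, j)"
    using ij by simp
  also have "\<dots> = (a * (of_nat n - 1 - 2 * of_nat i) * E a' b' c' i j +
      (if Suc i < n then b * ((of_nat i + 1) * (of_nat n - 1 - of_nat i)) * E a' b' c' (Suc i) j else 0) +
      (if i = 0 then 0 else c * E a' b' c' (i - 1) j)) -
      (a' * (of_nat n - 1 - 2 * of_nat i) * E a b c i j +
      (if Suc i < n then b' * ((of_nat i + 1) * (of_nat n - 1 - of_nat i)) * E a b c (Suc i) j else 0) +
      (if i = 0 then 0 else c' * E a b c (i - 1) j))"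
    using ij E by (simp only: std_sl2_mult_index[OF std_sl2_carrier ij] defs) (simp add: E defs del: One_nat_def)
  also have "\<dots> = E (b * c' - b' * c) (2 * (a * b' - a' * b)) (2 * (c * a' - c' * a)) i j"
  proof -
    consider "j = i" "i = 0" "Suc i < n" | "j = i" "i = 0" "n = 1" | k where "j = i" "i = Suc k" "Suc i < n"
      | k where "j = i" "i = Suc k" "n = Suc i" | "j = Suc i" | "i = Suc j" | "j = Suc (Suc i)" | "i = Suc (Suc j)"
      | "j \<noteq> i" "j \<noteq> Suc i" "i \<noteq> Suc j" "j \<noteq> Suc (Suc i)" "i \<noteq> Suc (Suc j)"
      using ij by (cases i) (force+)
    then show ?thesis
      by cases (use ij in \<open>(cases i; simp add: E_def; simp add: algebra_simps)+\<close>)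
  qed
  also have "\<dots> = std_sl2 n (sl2_bracket x y) $$ (i, j)"
    using ij by (simp only: E sl2_bracket_entries defs)
  finally show "std_sl2 n (sl2_bracket x y) $$ (i, j) =
      (std_sl2 n x * std_sl2 n y - std_sl2 n y * std_sl2 n x) $$ (i, j)" by simp
qed simp_all

definition std_word :: "nat \<Rightarrow> sl2 word \<Rightarrow> complex mat" where
  "std_word n w = foldr (\<lambda>x A. std_sl2 n x * A) (letters w) (1\<^sub>m n)"

text \<open>The extension to the free algebra is linear on words; it then descends to the enveloping algebra, because
  it annihilates the defining ideal.\<close>

definition std_free :: "nat \<Rightarrow> free_sl2 \<Rightarrow> complex mat" where
  "std_free n f = mat n n (\<lambda>(i, j).
     \<Sum>w\<in>Poly_Mapping.keys f. Poly_Mapping.lookup f w * std_word n w $$ (i, j))"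

lemma std_word_carrier: "std_word n w \<in> carrier_mat n n"
proof -
  have "foldr (\<lambda>x A. std_sl2 n x * A) xs (1\<^sub>m n) \<in> carrier_mat n n" for xs
    by (induction xs) (auto intro: mult_carrier_mat std_sl2_carrier)
  then show ?thesis by (simp add: std_word_def)
qed

lemma dim_std_word [simp]: "dim_row (std_word n w) = n" "dim_col (std_word n w) = n"
  using std_word_carrier[of n w] by auto

lemma std_word_add: "std_word n (v + w) = std_word n v * std_word n w"
proof -
  have "foldr (\<lambda>x A. std_sl2 n x * A) (xs @ letters w) (1\<^sub>m n) =
      foldr (\<lambda>x A. std_sl2 n x * A) xs (1\<^sub>m n) * std_word n w" for xs
  proof (induction xs)
    case Nil
    then show ?case using std_word_carrier[of n w] by (simp add: std_word_def)
  next
    case (Cons x xs)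
    have "foldr (\<lambda>x A. std_sl2 n x * A) xs (1\<^sub>m n) \<in> carrier_mat n n"
      using std_word_carrier[of n "Word xs"] by (simp add: std_word_def)
    from assoc_mult_mat[OF std_sl2_carrier this std_word_carrier]
    show ?case using Cons by simp
  qed
  from this[of "letters v"] show ?thesis
    by (simp add: std_word_def plus_word_def)
qed

lemma std_free_carrier: "std_free n f \<in> carrier_mat n n"
  by (simp add: std_free_def)

lemma dim_std_free [simp]: "dim_row (std_free n f) = n" "dim_col (std_free n f) = n"
  by (simp_all add: std_free_def)

lemma std_free_add: "std_free n (f + g) = std_free n f + std_free n g"
proof -
  let ?K = "Poly_Mapping.keys f \<union> Poly_Mapping.keys g"
  have *: "(\<Sum>w\<in>Poly_Mapping.keys h. Poly_Mapping.lookup h w * a w) =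
      (\<Sum>w\<in>?K. Poly_Mapping.lookup h w * a w)"
    if "Poly_Mapping.keys h \<subseteq> ?K" for h :: free_sl2 and a
    using that by (intro sum.mono_neutral_left) (auto simp: in_keys_iff)
  have "Poly_Mapping.keys (f + g) \<subseteq> ?K"
    by (rule Poly_Mapping.keys_add)
  note * = *[OF this] *[of f, OF Un_upper1] *[of g, OF Un_upper2]
  show ?thesis
    by (rule eq_matI)
      (simp_all only: std_free_def index_mat dim_row_mat dim_col_mat index_add_mat case_prod_conv *,
        simp_all add: lookup_add distrib_right sum.distrib)
qed

lemma std_free_single: "std_free n (Poly_Mapping.single w c) = c \<cdot>\<^sub>m std_word n w"
  by (rule eq_matI) (cases "c = 0"; simp add: std_free_def)+

lemma std_free_mult: "std_free n (f * g) = std_free n f * std_free n g"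
proof (induction f rule: poly_mapping_single_add_induct)
  case (single w c)
  show ?case
  proof (induction g rule: poly_mapping_single_add_induct)
    case (single w' c')
    have "c \<cdot>\<^sub>m std_word n w * (c' \<cdot>\<^sub>m std_word n w') = (c * c') \<cdot>\<^sub>m (std_word n w * std_word n w')"
      by (rule eq_matI)
        (simp_all add: mult_smult_assoc_mat[OF std_word_carrier smult_carrier_mat[OF std_word_carrier]]
          mult_smult_distrib[OF std_word_carrier std_word_carrier])
    then show ?case
      by (simp add: mult_single std_free_single std_word_add)
  next
    case (add g h)
    then show ?case
      by (simp add: distrib_left std_free_add
          mult_add_distrib_mat[OF std_free_carrier std_free_carrier std_free_carrier])
  qed
next
  case (add f h)
  then show ?case
    by (simp add: distrib_right std_free_add
        add_mult_distrib_mat[OF std_free_carrier std_free_carrier std_free_carrier])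
qed

lemma std_free_diff: "std_free n (f - g) = std_free n f - std_free n g"
proof -
  have "std_free n f = std_free n (f - g) + std_free n g"
    by (simp flip: std_free_add)
  then show ?thesis
    by (intro eq_matI) simp_all
qed

lemma std_free_gen: "std_free n (gen x) = std_sl2 n x"
proof -
  have "std_word n (Word [x]) = std_sl2 n x"
    by (simp add: std_word_def right_mult_one_mat')
  then show ?thesis
    by (intro eq_matI) (simp_all add: gen_def std_free_single)
qed

lemma std_free_const: "std_free n (const_free c * f) = c \<cdot>\<^sub>m std_free n f"
proof -
  have "std_free n (const_free c) = c \<cdot>\<^sub>m 1\<^sub>m n"
    by (simp add: const_free_def std_free_single std_word_def zero_word_def)
  then show ?thesis
    by (simp add: std_free_mult mult_smult_assoc_mat[OF one_carrier_mat std_free_carrier]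
        left_mult_one_mat[OF std_free_carrier])
qed

lemma std_free_env_ideal: "a \<in> env_ideal \<Longrightarrow> std_free n a = 0\<^sub>m n n"
proof (induction rule: env_ideal.induct)
  case (rel_bracket x y)
  then show ?case
    by (intro eq_matI) (simp_all add: std_free_diff std_free_mult std_free_gen std_sl2_bracket)
next
  case (mult_left a r)
  then show ?case
    by (simp add: std_free_mult right_mult_zero_mat[OF std_free_carrier])
next
  case (mult_right a r)
  then show ?case
    by (simp add: std_free_mult left_mult_zero_mat[OF std_free_carrier])
qed (intro eq_matI; simp add: std_free_diff std_free_add std_free_const std_free_gen std_sl2_add
    std_sl2_scale)+

lift_definition std :: "nat \<Rightarrow> Usl2 \<Rightarrow> complex mat" is std_free
proof -
  fix n and a b :: free_sl2
  assume "env_rel a b"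
  then have "std_free n (a - b) = 0\<^sub>m n n"
    by (simp add: env_rel_def std_free_env_ideal)
  then have "std_free n (a - b) + std_free n b = std_free n b"
    by (simp add: left_add_zero_mat[OF std_free_carrier])
  then show "std_free n a = std_free n b"
    by (simp flip: std_free_add)
qed

lemma std_incl: "std n (incl x) = std_sl2 n x"
  by transfer (rule std_free_gen)

lemma std_add: "std n (u + v) = std n u + std n v"
  by transfer (rule std_free_add)

lemma std_mult: "std n (u * v) = std n u * std n v"
  by transfer (rule std_free_mult)

lemma std_scale: "std n (c *\<^sub>U u) = c \<cdot>\<^sub>m std n u"
  by transfer (rule std_free_const)

lemma std_carrier: "std n u \<in> carrier_mat n n"
  by transfer (rule std_free_carrier)

lemma std_one: "std n 1 = 1\<^sub>m n"
proof transfer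
  show "std_free n 1 = 1\<^sub>m n" for n
    by (rule eq_matI) (simp_all add: std_free_single std_word_def zero_word_def flip: single_one)
qed

lemma representation_std: "representation n (std n)"
  unfolding representation_def by (simp add: std_one std_add std_mult std_scale std_carrier)

lemma Rep_sl2_basis [simp]:
  "Rep_sl2 sl2_X $$ (0, 0) = 0" "Rep_sl2 sl2_X $$ (0, Suc 0) = 1" "Rep_sl2 sl2_X $$ (Suc 0, 0) = 0"
  "Rep_sl2 sl2_Y $$ (0, 0) = 0" "Rep_sl2 sl2_Y $$ (0, Suc 0) = 0" "Rep_sl2 sl2_Y $$ (Suc 0, 0) = 1"
  "Rep_sl2 sl2_H $$ (0, 0) = 1" "Rep_sl2 sl2_H $$ (0, Suc 0) = 0" "Rep_sl2 sl2_H $$ (Suc 0, 0) = 0"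
  by (simp_all add: sl2_X.rep_eq sl2_Y.rep_eq sl2_H.rep_eq)

lemma dim_std [simp]: "dim_row (std n u) = n" "dim_col (std n u) = n"
  using std_carrier[of n u] by auto

lemma std_generator_mult_index:
  assumes "i < n" "j < n"
  shows "std n (UX * u) $$ (i, j) =
      (if Suc i < n then (of_nat i + 1) * (of_nat n - 1 - of_nat i) * std n u $$ (Suc i, j) else 0)"
    and "std n (UY * u) $$ (i, j) = (if i = 0 then 0 else std n u $$ (i - 1, j))"
    and "std n (UH * u) $$ (i, j) = (of_nat n - 1 - 2 * of_nat i) * std n u $$ (i, j)"
  using std_sl2_mult_index[OF std_carrier assms, of sl2_X u]
    std_sl2_mult_index[OF std_carrier assms, of sl2_Y u]
    std_sl2_mult_index[OF std_carrier assms, of sl2_H u]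
  by (simp_all add: std_mult std_incl del: index_mult_mat(1))

lemma std_generator_mult_vec:
  assumes "v \<in> carrier_vec n" "i < n"
  shows "(std n UX *\<^sub>v v) $ i =
      (if Suc i < n then (of_nat i + 1) * (of_nat n - 1 - of_nat i) * v $ Suc i else 0)"
    and "(std n UY *\<^sub>v v) $ i = (if i = 0 then 0 else v $ (i - 1))"
    and "(std n UH *\<^sub>v v) $ i = (of_nat n - 1 - 2 * of_nat i) * v $ i"
proof -
  define B where "B = mat n 1 (\<lambda>(i, _). v $ i)"
  have B: "B \<in> carrier_mat n 1"
    by (simp add: B_def)
  have 01: "0 < (1 :: nat)" by simp
  have "col B 0 = v"
    using assms by (intro eq_vecI) (simp_all add: B_def)
  then have *: "(std n (incl x) *\<^sub>v v) $ i = (std_sl2 n x * B) $$ (i, 0)" for x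
    using assms B by (simp add: std_incl)
  show "(std n UX *\<^sub>v v) $ i =
      (if Suc i < n then (of_nat i + 1) * (of_nat n - 1 - of_nat i) * v $ Suc i else 0)"
    "(std n UY *\<^sub>v v) $ i = (if i = 0 then 0 else v $ (i - 1))"
    "(std n UH *\<^sub>v v) $ i = (of_nat n - 1 - 2 * of_nat i) * v $ i"
    unfolding * using assms by (simp_all only: std_sl2_mult_index[OF B assms(2) 01])
      (simp_all add: B_def)
qed

lemma std_UH_power_right_index:
  assumes "i < n" "j < n"
  shows "std n (u * UH ^ b) $$ (i, j) = std n u $$ (i, j) * (of_nat n - 1 - 2 * of_nat j) ^ b"
proof -
  have H: "std n (UH ^ b) $$ (k, j) = (if k = j then (of_nat n - 1 - 2 * of_nat j) ^ b else 0)"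
    if "k < n" for k
    using assms that by (induction b) (simp_all add: std_one std_generator_mult_index)
  have "std n (u * UH ^ b) $$ (i, j) = (\<Sum>k<n. std n u $$ (i, k) * std n (UH ^ b) $$ (k, j))"
    using assms by (simp add: std_mult scalar_prod_def atLeast0LessThan)
  also have "\<dots> = (\<Sum>k<n. if k = j then std n u $$ (i, k) * (of_nat n - 1 - 2 * of_nat j) ^ b else 0)"
    by (intro sum.cong) (simp_all add: H)
  finally show ?thesis using assms by simp
qed

lemma std_casimir: "std n casimir = casimir_value n \<cdot>\<^sub>m 1\<^sub>m n"
proof (rule eq_matI)
  fix i j assume "i < dim_row (casimir_value n \<cdot>\<^sub>m 1\<^sub>m n)" "j < dim_col (casimir_value n \<cdot>\<^sub>m 1\<^sub>m n)"
  then have ij: "i < n" "j < n" by simp_all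
  note * = std_generator_mult_index[of _ n j 1, simplified mult_1_right] std_generator_mult_index[of _ n j "UX"]
    std_generator_mult_index[of _ n j "UH"]
  show "std n casimir $$ (i, j) = (casimir_value n \<cdot>\<^sub>m 1\<^sub>m n) $$ (i, j)"
    using ij by (cases i) (simp_all add: casimir_eqs(1) std_add std_scale * std_one casimir_value_def,
      auto simp add: field_simps power2_eq_square)
qed simp_all

lemma UX_coefficient_nonzero:
  "Suc i < n \<Longrightarrow> (of_nat i + 1) * (of_nat n - 1 - of_nat i) \<noteq> (0 :: complex)"
proof -
  assume "Suc i < n"
  then obtain k where "n = Suc (Suc (i + k))"
    using less_imp_Suc_add[of "Suc i" n] by auto
  then have "(of_nat i + 1) * (of_nat n - 1 - of_nat i) = (of_nat (Suc i * Suc k) :: complex)"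
    by (simp add: algebra_simps)
  then show ?thesis
    by (simp only: of_nat_eq_0_iff) simp
qed

text \<open>The matrix of \<open>weight_op e\<close> has nonzero entries exactly on the diagonal \<open>i - j = e\<close>. Nonvanishing on the whole
  diagonal is what later allows the entries to be cancelled.\<close>

lemma std_weight_op_index:
  assumes "i < n" "j < n"
  shows "std n (weight_op e) $$ (i, j) \<noteq> 0 \<longleftrightarrow> int i - int j = e"
proof -
  have Y: "std n (UY ^ k) $$ (i, j) \<noteq> 0 \<longleftrightarrow> i = j + k" if "i < n" for k i
    using that
  proof (induction k arbitrary: i)
    case 0
    then show ?case using assms by (simp add: std_one)
  next
    case (Suc k)
    then show ?case using assms by (cases i) (simp_all add: std_generator_mult_index)
  qed
  have X: "std n (UX ^ k) $$ (i, j) \<noteq> 0 \<longleftrightarrow> i + k = j" if "i < n" for k i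
    using that
  proof (induction k arbitrary: i)
    case 0
    then show ?case using assms by (simp add: std_one)
  next
    case (Suc k)
    then show ?case using assms UX_coefficient_nonzero[of i n]
      by (auto simp: std_generator_mult_index)
  qed
  show ?thesis
    using X[of i "nat (- e)"] Y[of i "nat e"] assms by (auto simp: weight_op_def)
qed

lemma subspace_vec_iff:
  "VectorSpace.subspace class_ring W (module_vec TYPE(complex) n) \<longleftrightarrow>
     W \<subseteq> carrier_vec n \<and> 0\<^sub>v n \<in> W \<and> (\<forall>v\<in>W. \<forall>w\<in>W. v + w \<in> W) \<and> (\<forall>c. \<forall>v\<in>W. c \<cdot>\<^sub>v v \<in> W)"
  unfolding VectorSpace.subspace_def submodule_def
  using vec_vs[where 'a = complex, of n] vec_module[where 'a = complex, of n]
  by (auto simp: module_vec_simps)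

text \<open>Applying \<open>X\<close> repeatedly to a nonzero vector of an invariant subspace moves its last nonzero coordinate to
  position \<open>0\<close> and leaves a multiple of \<open>v\<^sub>0\<close>; powers of \<open>Y\<close> then produce the whole basis.\<close>

lemma irreducible_std:
  assumes "n \<ge> 1"
  shows "irreducible_rep n (std n)"
  unfolding irreducible_rep_def
proof (intro conjI allI impI)
  fix W
  assume "VectorSpace.subspace class_ring W (module_vec TYPE(complex) n) \<and> (\<forall>u. \<forall>w\<in>W. std n u *\<^sub>v w \<in> W)"
  then have W: "W \<subseteq> carrier_vec n" "0\<^sub>v n \<in> W" "\<And>v w. v \<in> W \<Longrightarrow> w \<in> W \<Longrightarrow> v + w \<in> W"
    "\<And>c v. v \<in> W \<Longrightarrow> c \<cdot>\<^sub>v v \<in> W" and inv: "\<And>u w. w \<in> W \<Longrightarrow> std n u *\<^sub>v w \<in> W"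
    by (auto simp: subspace_vec_iff)
  have top: "unit_vec n 0 \<in> W" if "w \<in> W" "j < n" "w $ j \<noteq> 0" "\<And>i. j < i \<Longrightarrow> i < n \<Longrightarrow> w $ i = 0" for w j
    using that
  proof (induction j arbitrary: w)
    case 0
    then have "w \<in> carrier_vec n" using W by auto
    then have "unit_vec n 0 = (1 / w $ 0) \<cdot>\<^sub>v w"
      using 0 by (intro eq_vecI) auto
    then show ?case using 0 W by metis
  next
    case (Suc j)
    have w: "w \<in> carrier_vec n" using Suc W by auto
    note X = std_generator_mult_vec(1)[OF w]
    show ?case
    proof (rule Suc.IH)
      show "std n UX *\<^sub>v w \<in> W" using Suc inv by blast
      show "(std n UX *\<^sub>v w) $ j \<noteq> 0" using Suc UX_coefficient_nonzero[of j n] by (simp add: X del: index_mult_mat_vec)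
      show "(std n UX *\<^sub>v w) $ i = 0" if "j < i" "i < n" for i
        using Suc that by (simp add: X del: index_mult_mat_vec)
    qed (use Suc in simp)
  qed
  have full: "W = carrier_vec n" if 0: "unit_vec n 0 \<in> W"
  proof -
    have unit: "unit_vec n j \<in> W" if "j < n" for j
      using that
    proof (induction j)
      case (Suc j)
      then have "unit_vec n (Suc j) = std n UY *\<^sub>v unit_vec n j"
        by (intro eq_vecI) (auto simp: std_generator_mult_vec simp del: index_mult_mat_vec)
      then show ?case using Suc inv by simp
    qed (use 0 in simp)
    have "v \<in> W" if v: "v \<in> carrier_vec n" for v
    proof -
      have "vec n (\<lambda>i. if i < k then v $ i else 0) \<in> W" if "k \<le> n" for k
        using that
      proof (induction k)
        case 0
        have "vec n (\<lambda>i. if i < 0 then v $ i else 0) = 0\<^sub>v n"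
          by (intro eq_vecI) auto
        then show ?case using W by simp
      next
        case (Suc k)
        have "vec n (\<lambda>i. if i < Suc k then v $ i else 0) =
            vec n (\<lambda>i. if i < k then v $ i else 0) + v $ k \<cdot>\<^sub>v unit_vec n k"
          using Suc by (intro eq_vecI) (auto simp: less_Suc_eq)
        then show ?case using Suc W unit by simp
      qed
      moreover have "vec n (\<lambda>i. if i < n then v $ i else 0) = v"
        using v by (intro eq_vecI) auto
      ultimately show ?thesis by fastforce
    qed
    then show ?thesis using W by blast
  qed
  show "W = {0\<^sub>v n} \<or> W = carrier_vec n"
  proof (rule disjCI)
    assume "W \<noteq> carrier_vec n"
    then have *: "unit_vec n 0 \<notin> W" using full by blast
    have "w = 0\<^sub>v n" if w: "w \<in> W" for w
    proof (rule ccontr)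
      assume "w \<noteq> 0\<^sub>v n"
      moreover have "w \<in> carrier_vec n" using w W by blast
      ultimately obtain i where i: "i < n" "w $ i \<noteq> 0"
        by (metis carrier_vecD eq_vecI index_zero_vec)
      define j where "j = Max {i. i < n \<and> w $ i \<noteq> 0}"
      have "j \<in> {i. i < n \<and> w $ i \<noteq> 0}"
        unfolding j_def using i by (intro Max_in) auto
      moreover have "w $ i = 0" if "j < i" "i < n" for i
      proof (rule ccontr)
        assume "w $ i \<noteq> 0"
        then have "i \<le> j" unfolding j_def using that by (intro Max_ge) auto
        then show False using that by simp
      qed
      ultimately show False using top[OF w, of j] * by simp
    qed
    then show "W = {0\<^sub>v n}" using W by blast
  qed
qed (use assms representation_std in auto)

section \<open>Classification of the irreducible representations\<close>

context
  fixes n :: nat and \<pi> :: "Usl2 \<Rightarrow> complex mat"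
  assumes rep: "representation n \<pi>"
begin

lemma rep_carrier: "\<pi> u \<in> carrier_mat n n"
  and rep_one: "\<pi> 1 = 1\<^sub>m n"
  and rep_add: "\<pi> (u + v) = \<pi> u + \<pi> v"
  and rep_mult: "\<pi> (u * v) = \<pi> u * \<pi> v"
  and rep_scale: "\<pi> (c *\<^sub>U u) = c \<cdot>\<^sub>m \<pi> u"
  using rep by (simp_all add: representation_def)

lemma dim_rep: "dim_row (\<pi> u) = n" "dim_col (\<pi> u) = n"
  using rep_carrier[of u] by auto

lemma rep_zero: "\<pi> 0 = 0\<^sub>m n n"
proof -
  have "\<pi> 0 = 0 \<cdot>\<^sub>m \<pi> 0"
    using rep_scale[of 0 0] by simp
  also have "\<dots> = 0\<^sub>m n n"
    by (intro eq_matI) (simp_all add: dim_rep)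
  finally show ?thesis .
qed

lemma rep_diff: "\<pi> (u - v) = \<pi> u - \<pi> v"
proof -
  have "\<pi> u = \<pi> (u - v) + \<pi> v"
    by (simp flip: rep_add)
  then show ?thesis
    by (intro eq_matI) (simp_all add: dim_rep)
qed

lemma rep_sum_index:
  "i < n \<Longrightarrow> j < n \<Longrightarrow> \<pi> (sum f A) $$ (i, j) = (\<Sum>x\<in>A. \<pi> (f x) $$ (i, j))"
  by (induction A rule: infinite_finite_induct) (simp_all add: rep_zero rep_add dim_rep)

lemma rep_mult_vec: "v \<in> carrier_vec n \<Longrightarrow> \<pi> (u * w) *\<^sub>v v = \<pi> u *\<^sub>v (\<pi> w *\<^sub>v v)"
  unfolding rep_mult by (rule assoc_mult_mat_vec[OF rep_carrier rep_carrier])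

lemma rep_vec_carrier: "\<pi> u *\<^sub>v v \<in> carrier_vec n"
  by (rule carrier_vecI) (simp add: dim_rep)

lemma rep_add_vec: "v \<in> carrier_vec n \<Longrightarrow> \<pi> (u + w) *\<^sub>v v = \<pi> u *\<^sub>v v + \<pi> w *\<^sub>v v"
  unfolding rep_add by (rule add_mult_distrib_mat_vec[OF rep_carrier rep_carrier])

lemma rep_diff_vec: "v \<in> carrier_vec n \<Longrightarrow> \<pi> (u - w) *\<^sub>v v = \<pi> u *\<^sub>v v - \<pi> w *\<^sub>v v"
  unfolding rep_diff by (rule minus_mult_distrib_mat_vec[OF rep_carrier rep_carrier])

lemma rep_scale_vec: "v \<in> carrier_vec n \<Longrightarrow> \<pi> (c *\<^sub>U u) *\<^sub>v v = c \<cdot>\<^sub>v (\<pi> u *\<^sub>v v)"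
  by (intro eq_vecI) (simp_all add: rep_scale dim_rep)

lemma rep_zero_vec: "\<pi> u *\<^sub>v 0\<^sub>v n = 0\<^sub>v n"
  by (intro eq_vecI) (auto simp: dim_rep scalar_prod_def)

lemma rep_poly_casimir:
  assumes "\<pi> casimir = c \<cdot>\<^sub>m 1\<^sub>m n"
  shows "\<pi> (poly_casimir z * u) = poly z c \<cdot>\<^sub>m \<pi> u"
proof -
  have "\<pi> (poly_casimir z) = poly z c \<cdot>\<^sub>m 1\<^sub>m n"
  proof (induction z)
    case 0
    show ?case by (intro eq_matI) (simp_all add: rep_zero)
  next
    case (pCons a z)
    have "\<pi> (poly_casimir (pCons a z)) = a \<cdot>\<^sub>m 1\<^sub>m n + (c \<cdot>\<^sub>m 1\<^sub>m n) * (poly z c \<cdot>\<^sub>m 1\<^sub>m n)"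
      by (simp add: poly_casimir_pCons rep_add rep_mult rep_scale rep_one assms pCons)
    also have "(c \<cdot>\<^sub>m 1\<^sub>m n) * (poly z c \<cdot>\<^sub>m 1\<^sub>m n) = (c * poly z c) \<cdot>\<^sub>m (1\<^sub>m n :: complex mat)"
      by (intro eq_matI) (simp_all add: mult_smult_assoc_mat[of _ n n _ n])
    finally show ?case by (simp add: distrib_right flip: add_smult_distrib_right_mat[of _ n n])
  qed
  then have "\<pi> (poly_casimir z * u) = (poly z c \<cdot>\<^sub>m 1\<^sub>m n) * \<pi> u"
    by (simp only: rep_mult)
  also have "\<dots> = poly z c \<cdot>\<^sub>m (1\<^sub>m n * \<pi> u)"
    by (rule mult_smult_assoc_mat[OF one_carrier_mat rep_carrier])
  also have "1\<^sub>m n * \<pi> u = \<pi> u"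
    by (rule left_mult_one_mat[OF rep_carrier])
  finally show ?thesis .
qed

lemma weight_op_eigenvector:
  assumes w: "w \<in> carrier_vec n" and H: "\<pi> UH *\<^sub>v w = \<mu> \<cdot>\<^sub>v w"
  shows "\<pi> UH *\<^sub>v (\<pi> (weight_op e) *\<^sub>v w) = (\<mu> - 2 * of_int e) \<cdot>\<^sub>v (\<pi> (weight_op e) *\<^sub>v w)"
proof -
  have "\<pi> UH *\<^sub>v (\<pi> (weight_op e) *\<^sub>v w) = \<pi> (UH * weight_op e) *\<^sub>v w"
    using w by (simp add: rep_mult_vec)
  also have "\<dots> = \<pi> (weight_op e) *\<^sub>v (\<pi> UH *\<^sub>v w) - (2 * of_int e) \<cdot>\<^sub>v (\<pi> (weight_op e) *\<^sub>v w)"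
    using w by (simp add: UH_weight_op rep_diff_vec rep_scale_vec rep_mult_vec)
  also have "\<dots> =
      \<mu> \<cdot>\<^sub>v (\<pi> (weight_op e) *\<^sub>v w) - (2 * of_int e) \<cdot>\<^sub>v (\<pi> (weight_op e) *\<^sub>v w)"
    using w by (simp add: H mult_mat_vec[OF rep_carrier])
  also have "\<dots> = (\<mu> - 2 * of_int e) \<cdot>\<^sub>v (\<pi> (weight_op e) *\<^sub>v w)"
    by (intro eq_vecI) (simp_all only: index_minus_vec index_smult_vec left_diff_distrib)
  finally show ?thesis .
qed

text \<open>Otherwise the vectors obtained from \<open>w\<close> would be eigenvectors of \<open>H\<close> for infinitely many eigenvalues. The map
  \<open>f\<close> selects a direction: with \<open>f k = - k\<close> it shows that some power of \<open>X\<close> kills \<open>w\<close>, with \<open>f k = k\<close> the same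
  for \<open>Y\<close>.\<close>

lemma weight_op_nilpotent:
  assumes w: "w \<in> carrier_vec n" and H: "\<pi> UH *\<^sub>v w = \<mu> \<cdot>\<^sub>v w" and f: "inj f"
  shows "\<exists>k :: nat. \<pi> (weight_op (f k)) *\<^sub>v w = 0\<^sub>v n"
proof (rule ccontr)
  assume *: "\<nexists>k. \<pi> (weight_op (f k)) *\<^sub>v w = 0\<^sub>v n"
  have "range (\<lambda>k. \<mu> - 2 * of_int (f k)) \<subseteq> spectrum (\<pi> UH)"
  proof
    fix x assume "x \<in> range (\<lambda>k. \<mu> - 2 * of_int (f k))"
    then obtain k where x: "x = \<mu> - 2 * of_int (f k)" by (elim rangeE)
    have "eigenvector (\<pi> UH) (\<pi> (weight_op (f k)) *\<^sub>v w) x"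
      using * weight_op_eigenvector[OF w H, of "f k"]
      by (simp add: eigenvector_def rep_vec_carrier dim_rep x del: index_mult_mat_vec)
    then show "x \<in> spectrum (\<pi> UH)"
      by (auto simp: spectrum_def eigenvalue_def)
  qed
  then have "finite (range (\<lambda>k. \<mu> - 2 * of_int (f k)))"
    by (rule finite_subset) (rule card_finite_spectrum(1)[OF rep_carrier])
  moreover have "inj (\<lambda>k. \<mu> - 2 * of_int (f k))"
    using f by (auto simp: inj_def)
  ultimately show False
    by (simp add: range_inj_infinite)
qed

text \<open>Start from any eigenvector of \<open>H\<close> and apply \<open>X\<close> as long as the result is not zero.\<close>

lemma highest_weight_vector:
  assumes "n \<noteq> 0"
  obtains v \<mu> where "v \<in> carrier_vec n" "v \<noteq> 0\<^sub>v n" "\<pi> UX *\<^sub>v v = 0\<^sub>v n" "\<pi> UH *\<^sub>v v = \<mu> \<cdot>\<^sub>v v"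
proof -
  obtain \<nu> where "\<nu> \<in> spectrum (\<pi> UH)"
    using spectrum_non_empty[OF rep_carrier, of UH] assms by auto
  then obtain w where w: "w \<in> carrier_vec n" "w \<noteq> 0\<^sub>v n" "\<pi> UH *\<^sub>v w = \<nu> \<cdot>\<^sub>v w"
    by (auto simp: spectrum_def eigenvalue_def eigenvector_def dim_rep)
  let ?x = "\<lambda>k. \<pi> (weight_op (- int k)) *\<^sub>v w"
  have "\<exists>k. ?x k = 0\<^sub>v n"
    by (rule weight_op_nilpotent[OF w(1,3)]) (simp add: inj_def)
  moreover have "?x 0 \<noteq> 0\<^sub>v n"
    using w by (simp add: weight_op_def rep_one)
  ultimately obtain k where k: "?x k \<noteq> 0\<^sub>v n" "?x (Suc k) = 0\<^sub>v n"
    using exists_least_lemma[of "\<lambda>k. ?x k = 0\<^sub>v n"] by auto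
  have "weight_op (- int (Suc k)) = UX * weight_op (- int k)"
    by (simp add: weight_op_def nat_add_distrib)
  then have "\<pi> UX *\<^sub>v ?x k = 0\<^sub>v n"
    using k w by (simp add: rep_mult_vec)
  then show ?thesis
    using that[OF rep_vec_carrier k(1) _ weight_op_eigenvector[OF w(1,3), of "- int k"]] by simp
qed

text \<open>On the whole string \<open>Y\<^sup>j v\<close> the Casimir element has the same eigenvalue \<open>\<mu> + \<mu>\<^sup>2 / 2\<close> as on \<open>v\<close>. Since \<open>XY\<close> is a
  polynomial in \<open>C\<close> and \<open>H\<close>, its eigenvalue on \<open>Y\<^sup>j v\<close> can be read off without an induction on \<open>j\<close>.\<close>

lemma UX_on_weight_string:
  assumes v: "v \<in> carrier_vec n" "\<pi> UX *\<^sub>v v = 0\<^sub>v n" "\<pi> UH *\<^sub>v v = \<mu> \<cdot>\<^sub>v v"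
  shows "\<pi> UX *\<^sub>v (\<pi> (UY ^ Suc j) *\<^sub>v v) = ((of_nat j + 1) * (\<mu> - of_nat j)) \<cdot>\<^sub>v (\<pi> (UY ^ j) *\<^sub>v v)"
proof -
  let ?v = "\<pi> (UY ^ j) *\<^sub>v v"
  have v': "?v \<in> carrier_vec n" by (rule rep_vec_carrier)
  have H: "\<pi> UH *\<^sub>v ?v = (\<mu> - 2 * of_nat j) \<cdot>\<^sub>v ?v"
    using weight_op_eigenvector[OF v(1,3), of "int j"] by (simp add: weight_op_def)
  have C0: "\<pi> casimir *\<^sub>v v = (\<mu> + \<mu> * \<mu> / 2) \<cdot>\<^sub>v v"
    using v by (simp add: casimir_eqs(1) rep_add_vec rep_scale_vec rep_mult_vec mult_mat_vec[OF rep_carrier] rep_zero_vec)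
      (intro eq_vecI, auto simp: algebra_simps)
  have C: "\<pi> casimir *\<^sub>v ?v = (\<mu> + \<mu> * \<mu> / 2) \<cdot>\<^sub>v ?v"
  proof -
    have "\<pi> casimir *\<^sub>v ?v = \<pi> (UY ^ j * casimir) *\<^sub>v v"
      using v by (metis casimir_commute rep_mult_vec)
    also have "\<dots> = (\<mu> + \<mu> * \<mu> / 2) \<cdot>\<^sub>v ?v"
      using v by (simp only: rep_mult_vec C0 mult_mat_vec[OF rep_carrier])
    finally show ?thesis .
  qed
  have "\<pi> UX *\<^sub>v (\<pi> (UY ^ Suc j) *\<^sub>v v) = \<pi> (UX * UY) *\<^sub>v ?v"
    using v v' by (simp add: rep_mult_vec)
  also have "\<dots> = (1 / 2) \<cdot>\<^sub>v (\<pi> casimir *\<^sub>v ?v + \<pi> UH *\<^sub>v ?v - (1 / 2) \<cdot>\<^sub>v (\<pi> UH *\<^sub>v (\<pi> UH *\<^sub>v ?v)))"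
    using v' by (simp add: UX_UY_eq rep_scale_vec rep_diff_vec rep_add_vec rep_mult_vec)
  also have "\<dots> = ((of_nat j + 1) * (\<mu> - of_nat j)) \<cdot>\<^sub>v ?v"
    unfolding C H using v' by (simp add: mult_mat_vec[OF rep_carrier] H)
      (intro eq_vecI, auto simp: field_simps)
  finally show ?thesis .
qed

lemma rep_intertwines_std:
  assumes P: "P \<in> carrier_mat n m"
    and "\<pi> UX * P = P * std m UX" "\<pi> UY * P = P * std m UY" "\<pi> UH * P = P * std m UH"
  shows "\<pi> u * P = P * std m u"
proof (induction u rule: Usl2_induct)
  case scalar
  then show ?case using P by (simp add: rep_one std_one)
next
  case (add u v)
  then show ?case using P
    by (simp add: rep_add std_add add_mult_distrib_mat[OF rep_carrier rep_carrier]
        mult_add_distrib_mat[OF _ std_carrier std_carrier])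
next
  case (scale c u)
  then show ?case using P
    by (simp add: rep_scale std_scale mult_smult_assoc_mat[OF rep_carrier] mult_smult_distrib[OF _ std_carrier])
next
  have step: "\<pi> (g * u) * P = P * std m (g * u)"
    if "\<pi> g * P = P * std m g" "\<pi> u * P = P * std m u" for g u
  proof -
    have "\<pi> (g * u) * P = \<pi> g * (\<pi> u * P)"
      using P by (simp add: rep_mult assoc_mult_mat[OF rep_carrier rep_carrier])
    also have "\<dots> = (\<pi> g * P) * std m u"
      using that assoc_mult_mat[OF rep_carrier P std_carrier, of g u] by simp
    also have "\<dots> = P * std m (g * u)"
      using P by (simp add: that std_mult assoc_mult_mat[OF _ std_carrier std_carrier])
    finally show ?thesis .
  qed
  {
    case (X u)
    then show ?case using step assms by blast
  next
    case (Y u)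
    then show ?case using step assms by blast
  next
    case (H u)
    then show ?case using step assms by blast
  }
qed

end

lemma mat_unit_vec_col:
  fixes A :: "'a :: semiring_1 mat"
  assumes "A \<in> carrier_mat n m" "j < m"
  shows "A *\<^sub>v unit_vec m j = col A j"
  using assms by (intro eq_vecI) auto

lemma vec_diff_zeroD:
  fixes x y :: "'a :: group_add vec"
  assumes "x \<in> carrier_vec m" "y \<in> carrier_vec m" "x - y = 0\<^sub>v m"
  shows "x = y"
proof (rule eq_vecI)
  fix i assume "i < dim_vec y"
  then have "(x - y) $ i = x $ i - y $ i" "(x - y) $ i = 0"
    using assms(2) by (simp, simp add: assms(3))
  then show "x $ i = y $ i" by simp
qed (use assms in simp)

lemma vec_index_eq: "w \<in> carrier_vec n \<Longrightarrow> vec n (($) w) = w"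
  by (intro eq_vecI) auto

lemma mat_eq_unit_vecI:
  fixes A B :: "'a :: semiring_1 mat"
  assumes "A \<in> carrier_mat n m" "B \<in> carrier_mat n m"
    and "\<And>j. j < m \<Longrightarrow> A *\<^sub>v unit_vec m j = B *\<^sub>v unit_vec m j"
  shows "A = B"
proof (rule mat_col_eqI)
  fix j assume "j < dim_col B"
  then show "col A j = col B j"
    using assms mat_unit_vec_col[of A n m j] mat_unit_vec_col[of B n m j] by simp
qed (use assms in auto)

text \<open>The traces of \<open>P Q\<close> and \<open>Q P\<close> agree.\<close>

lemma two_sided_inverse_square:
  fixes P Q :: "complex mat"
  assumes "P \<in> carrier_mat n m" "Q \<in> carrier_mat m n" "P * Q = 1\<^sub>m n" "Q * P = 1\<^sub>m m"
  shows "n = m"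
proof -
  have "of_nat n = (\<Sum>i<n. (P * Q) $$ (i, i))"
    using assms(3) by simp
  also have "\<dots> = (\<Sum>i<n. \<Sum>j<m. P $$ (i, j) * Q $$ (j, i))"
    using assms(1,2) by (intro sum.cong) (auto simp: scalar_prod_def atLeast0LessThan)
  also have "\<dots> = (\<Sum>j<m. \<Sum>i<n. Q $$ (j, i) * P $$ (i, j))"
    by (subst sum.swap) (simp add: mult.commute)
  also have "\<dots> = (\<Sum>j<m. (Q * P) $$ (j, j))"
    using assms(1,2) by (intro sum.cong) (auto simp: scalar_prod_def atLeast0LessThan)
  also have "\<dots> = of_nat m"
    using assms(4) by simp
  finally show ?thesis by (simp only: of_nat_eq_iff)
qed

lemma injective_surjective_mat_inverse:
  fixes P :: "complex mat"
  assumes P: "P \<in> carrier_mat n m"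
    and inj: "\<And>a. a \<in> carrier_vec m \<Longrightarrow> P *\<^sub>v a = 0\<^sub>v n \<Longrightarrow> a = 0\<^sub>v m"
    and surj: "\<And>b. b \<in> carrier_vec n \<Longrightarrow> \<exists>a\<in>carrier_vec m. P *\<^sub>v a = b"
  obtains Q where "n = m" "Q \<in> carrier_mat m n" "P * Q = 1\<^sub>m n" "Q * P = 1\<^sub>m m"
proof -
  have "\<forall>i. \<exists>a. i < n \<longrightarrow> a \<in> carrier_vec m \<and> P *\<^sub>v a = unit_vec n i"
    using surj unit_vec_carrier by blast
  then obtain q where q: "\<And>i. i < n \<Longrightarrow> q i \<in> carrier_vec m" "\<And>i. i < n \<Longrightarrow> P *\<^sub>v q i = unit_vec n i"
    by metis
  define Q where "Q = mat m n (\<lambda>(j, i). q i $ j)"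
  have Q: "Q \<in> carrier_mat m n"
    by (simp add: Q_def)
  have Qi: "Q *\<^sub>v unit_vec n i = q i" if "i < n" for i
    using that q(1)[OF that] mat_unit_vec_col[OF Q that] by (intro eq_vecI) (auto simp: Q_def)
  have PQ: "P * Q = 1\<^sub>m n"
  proof (rule mat_eq_unit_vecI)
    fix i assume "i < n"
    then show "(P * Q) *\<^sub>v unit_vec n i = 1\<^sub>m n *\<^sub>v unit_vec n i"
      by (simp add: assoc_mult_mat_vec[OF P Q] Qi q(2))
  qed (use P Q in auto)
  have QP: "Q * P = 1\<^sub>m m"
  proof (rule mat_eq_unit_vecI)
    fix j assume "j < m"
    let ?e = "unit_vec m j :: complex vec"
    let ?d = "(Q * P) *\<^sub>v ?e - ?e"
    have d: "?d \<in> carrier_vec m" "(Q * P) *\<^sub>v ?e \<in> carrier_vec m"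
      using P Q by auto
    have "P *\<^sub>v ((Q * P) *\<^sub>v ?e) = (P * Q) *\<^sub>v (P *\<^sub>v ?e)"
      using P Q by (simp add: assoc_mult_mat_vec[OF P Q] assoc_mult_mat_vec[OF Q P])
    then have "P *\<^sub>v ?d = 0\<^sub>v n"
      using P d by (simp add: PQ mult_minus_distrib_mat_vec[OF P])
    then have "?d = 0\<^sub>v m"
      by (rule inj[OF d(1)])
    then have "(Q * P) *\<^sub>v ?e = ?e"
      by (rule vec_diff_zeroD[OF d(2) unit_vec_carrier])
    then show "(Q * P) *\<^sub>v ?e = 1\<^sub>m m *\<^sub>v ?e"
      by simp
  qed (use P Q in auto)
  show ?thesis
    using that[OF two_sided_inverse_square[OF P Q PQ QP] Q PQ QP] .
qed

text \<open>Let \<open>m\<close> be the length of the string \<open>v, Y v, Y\<^sup>2 v, \<dots>\<close> of a highest weight vector \<open>v\<close> before it reaches zero.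
  Applying \<open>X\<close> to the first vanishing member shows that the weight of \<open>v\<close> is \<open>m - 1\<close>, so that the generators
  act on the string as in the standard representation of dimension \<open>m\<close>.\<close>

lemma highest_weight_intertwiner:
  assumes rep: "representation n \<pi>" and n: "n \<noteq> 0"
  obtains m P where "m \<ge> 1" "P \<in> carrier_mat n m" "\<And>u. \<pi> u * P = P * std m u"
    "P *\<^sub>v unit_vec m 0 \<noteq> 0\<^sub>v n"
proof -
  obtain v \<mu> where v: "v \<in> carrier_vec n" "v \<noteq> 0\<^sub>v n" "\<pi> UX *\<^sub>v v = 0\<^sub>v n" "\<pi> UH *\<^sub>v v = \<mu> \<cdot>\<^sub>v v"
    using highest_weight_vector[OF rep n] by blast
  let ?v = "\<lambda>j. \<pi> (UY ^ j) *\<^sub>v v"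
  have vc: "?v j \<in> carrier_vec n" for j
    by (rule rep_vec_carrier[OF rep])
  have wt: "weight_op (int j) = UY ^ j" for j
    by (simp add: weight_op_def)
  have v0: "?v 0 = v"
    using v(1) by (simp add: rep_one[OF rep])
  have vSuc: "\<pi> UY *\<^sub>v ?v j = ?v (Suc j)" for j
    using v(1) by (simp add: rep_mult_vec[OF rep])
  have "\<exists>j. ?v j = 0\<^sub>v n"
    using weight_op_nilpotent[OF rep v(1,4), of int] by (simp add: wt)
  moreover have "?v 0 \<noteq> 0\<^sub>v n"
    using v v0 by simp
  ultimately obtain m' where m': "?v m' \<noteq> 0\<^sub>v n" "?v (Suc m') = 0\<^sub>v n"
    using exists_least_lemma[of "\<lambda>j. ?v j = 0\<^sub>v n"] by auto
  have "((of_nat m' + 1) * (\<mu> - of_nat m')) \<cdot>\<^sub>v ?v m' = 0\<^sub>v n"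
    using UX_on_weight_string[OF rep v(1,3,4), of m'] m'(2) rep_zero_vec[OF rep, of UX] by simp
  moreover obtain i where "i < n" "?v m' $ i \<noteq> 0"
    using m'(1) vc[of m'] by (metis carrier_vecD eq_vecI index_zero_vec)
  ultimately have "(of_nat m' + 1) * (\<mu> - of_nat m') = 0"
    using vc[of m'] by (metis carrier_vecD index_smult_vec(1) index_zero_vec(1) mult_eq_0_iff)
  moreover have "of_nat m' + 1 \<noteq> (0 :: complex)"
    by (metis of_nat_Suc of_nat_eq_0_iff nat.distinct(1) add.commute)
  ultimately have \<mu>: "\<mu> = of_nat m'" by simp
  define m where "m = Suc m'"
  have of_m: "(of_nat m :: complex) = of_nat m' + 1"
    by (simp add: m_def)
  define P where "P = mat n m (\<lambda>(i, j). ?v j $ i)"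
  have P: "P \<in> carrier_mat n m"
    by (simp add: P_def)
  have col: "P *\<^sub>v unit_vec m j = ?v j" if "j < m" for j
    using that mat_unit_vec_col[OF P that] by (simp add: P_def vec_index_eq[OF vc])
  have intertw: "\<pi> g * P = P * std m g"
    if "\<And>j. j < m \<Longrightarrow> \<pi> g *\<^sub>v ?v j = P *\<^sub>v (std m g *\<^sub>v unit_vec m j)" for g
  proof (rule mat_eq_unit_vecI[of _ n m])
    fix j assume "j < m"
    then show "(\<pi> g * P) *\<^sub>v unit_vec m j = (P * std m g) *\<^sub>v unit_vec m j"
      using that by (simp add: assoc_mult_mat_vec[OF rep_carrier[OF rep] P]
          assoc_mult_mat_vec[OF P std_carrier] col)
  qed (intro mult_carrier_mat[OF rep_carrier[OF rep] P] mult_carrier_mat[OF P std_carrier])+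
  have "\<pi> u * P = P * std m u" for u
  proof (rule rep_intertwines_std[OF rep P]; rule intertw)
    fix j assume j: "j < m"
    note std = std_generator_mult_vec[OF unit_vec_carrier]
    show "\<pi> UX *\<^sub>v ?v j = P *\<^sub>v (std m UX *\<^sub>v unit_vec m j)"
    proof (cases j)
      case 0
      have "std m UX *\<^sub>v unit_vec m 0 = 0\<^sub>v m"
        by (intro eq_vecI) (auto simp: std simp del: index_mult_mat_vec)
      moreover have "P *\<^sub>v 0\<^sub>v m = 0\<^sub>v n"
        using P by (intro eq_vecI) auto
      ultimately show ?thesis using v v0 0 by simp
    next
      case (Suc k)
      have "std m UX *\<^sub>v unit_vec m j = ((of_nat k + 1) * (of_nat m - 1 - of_nat k)) \<cdot>\<^sub>v unit_vec m k"
        using j Suc by (intro eq_vecI) (auto simp: std simp del: index_mult_mat_vec)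
      then show ?thesis
        using UX_on_weight_string[OF rep v(1,3,4), of k] j Suc \<mu>
        by (simp add: mult_mat_vec[OF P] col of_m del: power_Suc)
    qed
    show "\<pi> UY *\<^sub>v ?v j = P *\<^sub>v (std m UY *\<^sub>v unit_vec m j)"
    proof (cases "Suc j < m")
      case True
      then have "std m UY *\<^sub>v unit_vec m j = unit_vec m (Suc j)"
        by (intro eq_vecI) (auto simp: std simp del: index_mult_mat_vec)
      then show ?thesis using True by (simp only: vSuc col)
    next
      case False
      then have "std m UY *\<^sub>v unit_vec m j = 0\<^sub>v m"
        using j by (intro eq_vecI) (auto simp: std simp del: index_mult_mat_vec)
      moreover have "P *\<^sub>v 0\<^sub>v m = 0\<^sub>v n"
        using P by (intro eq_vecI) auto
      moreover have "j = m'" using False j by (simp add: m_def)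
      ultimately show ?thesis using m'(2) by (simp only: vSuc)
    qed
    have "\<pi> UH *\<^sub>v ?v j = (\<mu> - 2 * of_nat j) \<cdot>\<^sub>v ?v j"
      using weight_op_eigenvector[OF rep v(1,4), of "int j"] by (simp add: wt)
    moreover have "std m UH *\<^sub>v unit_vec m j = (of_nat m - 1 - 2 * of_nat j) \<cdot>\<^sub>v unit_vec m j"
      using j by (intro eq_vecI) (auto simp: std simp del: index_mult_mat_vec)
    ultimately show "\<pi> UH *\<^sub>v ?v j = P *\<^sub>v (std m UH *\<^sub>v unit_vec m j)"
      using j \<mu> by (simp add: mult_mat_vec[OF P] col of_m)
  qed
  moreover have "P *\<^sub>v unit_vec m 0 \<noteq> 0\<^sub>v n"
    using v v0 col[of 0] by (simp add: m_def)
  ultimately show ?thesis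
    using that[of m P] P by (simp add: m_def)
qed

text \<open>Schur's argument: the image of the intertwiner is an invariant subspace of the given representation and
  its kernel one of the standard representation. Both representations are irreducible and the intertwiner is not
  zero, hence it is bijective and the two dimensions coincide.\<close>

lemma irreducible_rep_equivalent_std:
  assumes "irreducible_rep n \<pi>"
  obtains P Q where "P \<in> carrier_mat n n" "Q \<in> carrier_mat n n" "P * Q = 1\<^sub>m n" "Q * P = 1\<^sub>m n"
    "\<And>u. \<pi> u * P = P * std n u" "n \<ge> 1"
proof -
  have rep: "representation n \<pi>" and n: "n \<noteq> 0"
    and irr: "\<And>W. VectorSpace.subspace class_ring W (module_vec TYPE(complex) n) \<Longrightarrow>
      (\<And>u w. w \<in> W \<Longrightarrow> \<pi> u *\<^sub>v w \<in> W) \<Longrightarrow> W = {0\<^sub>v n} \<or> W = carrier_vec n"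
    using assms by (auto simp: irreducible_rep_def)
  obtain m P where m: "m \<ge> 1" and P: "P \<in> carrier_mat n m" and int: "\<And>u. \<pi> u * P = P * std m u"
    and P0: "P *\<^sub>v unit_vec m 0 \<noteq> 0\<^sub>v n"
    using highest_weight_intertwiner[OF rep n] by blast
  have int_vec: "\<pi> u *\<^sub>v (P *\<^sub>v a) = P *\<^sub>v (std m u *\<^sub>v a)" if "a \<in> carrier_vec m" for u a
    using int[of u] assoc_mult_mat_vec[OF rep_carrier[OF rep] P that, of u]
      assoc_mult_mat_vec[OF P std_carrier that, of u] by simp
  have Pzero: "P *\<^sub>v 0\<^sub>v m = 0\<^sub>v n"
    using P by (intro eq_vecI) auto
  have std_vec: "std m u *\<^sub>v a \<in> carrier_vec m" for u a
    by (rule rep_vec_carrier[OF representation_std])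
  have Pc: "P *\<^sub>v a \<in> carrier_vec n" for a
    using P by (intro carrier_vecI) simp
  define W where "W = (\<lambda>a. P *\<^sub>v a) ` carrier_vec m"
  have "W = {0\<^sub>v n} \<or> W = carrier_vec n"
  proof (rule irr)
    show "VectorSpace.subspace class_ring W (module_vec TYPE(complex) n)"
      unfolding subspace_vec_iff
    proof (intro conjI ballI allI)
      show "W \<subseteq> carrier_vec n" using Pc by (auto simp: W_def)
      show "0\<^sub>v n \<in> W" unfolding W_def by (rule image_eqI[of _ _ "0\<^sub>v m"]) (simp_all add: Pzero)
    next
      fix v w assume "v \<in> W" "w \<in> W"
      then obtain a b where "a \<in> carrier_vec m" "v = P *\<^sub>v a" "b \<in> carrier_vec m" "w = P *\<^sub>v b"
        by (auto simp: W_def)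
      then show "v + w \<in> W"
        unfolding W_def by (intro image_eqI[of _ _ "a + b"]) (simp_all add: mult_add_distrib_mat_vec[OF P])
    next
      fix c v assume "v \<in> W"
      then obtain a where "a \<in> carrier_vec m" "v = P *\<^sub>v a"
        by (auto simp: W_def)
      then show "c \<cdot>\<^sub>v v \<in> W"
        unfolding W_def by (intro image_eqI[of _ _ "c \<cdot>\<^sub>v a"]) (simp_all add: mult_mat_vec[OF P])
    qed
  next
    fix u w assume "w \<in> W"
    then show "\<pi> u *\<^sub>v w \<in> W"
      using std_vec by (auto simp: W_def int_vec)
  qed
  moreover have "P *\<^sub>v unit_vec m 0 \<in> W"
    unfolding W_def by (rule imageI) simp
  ultimately have W: "W = carrier_vec n"
    using P0 by blast
  define K where "K = {a \<in> carrier_vec m. P *\<^sub>v a = 0\<^sub>v n}"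
  have "K = {0\<^sub>v m} \<or> K = carrier_vec m"
  proof -
    have "VectorSpace.subspace class_ring K (module_vec TYPE(complex) m)"
      unfolding subspace_vec_iff K_def
      by (auto simp: Pzero mult_add_distrib_mat_vec[OF P] mult_mat_vec[OF P])
    moreover have "std m u *\<^sub>v a \<in> K" if "a \<in> K" for u a
      using that std_vec by (simp add: K_def rep_zero_vec[OF rep] flip: int_vec)
    ultimately show ?thesis
      using irreducible_std[OF m] unfolding irreducible_rep_def by blast
  qed
  moreover have "unit_vec m 0 \<notin> K"
    using P0 by (simp add: K_def)
  ultimately have K: "K = {0\<^sub>v m}"
    using unit_vec_carrier by blast
  obtain Q where "n = m" "Q \<in> carrier_mat m n" "P * Q = 1\<^sub>m n" "Q * P = 1\<^sub>m m"
  proof (rule injective_surjective_mat_inverse[OF P])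
    show "a = 0\<^sub>v m" if "a \<in> carrier_vec m" "P *\<^sub>v a = 0\<^sub>v n" for a
      using that K by (auto simp: K_def)
    show "\<exists>a\<in>carrier_vec m. P *\<^sub>v a = b" if "b \<in> carrier_vec n" for b
    proof -
      have "b \<in> W" using that W by simp
      then show ?thesis by (auto simp: W_def)
    qed
  qed
  then show ?thesis
    using that[of P Q] P int n by simp
qed

lemma irreducible_rep_casimir:
  assumes "irreducible_rep n \<pi>"
  shows "\<pi> casimir = casimir_value n \<cdot>\<^sub>m 1\<^sub>m n"
proof -
  have rep: "representation n \<pi>"
    using assms by (simp add: irreducible_rep_def)
  obtain P Q where P: "P \<in> carrier_mat n n" "Q \<in> carrier_mat n n" "P * Q = 1\<^sub>m n"
    and int: "\<pi> casimir * P = P * std n casimir"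
    using irreducible_rep_equivalent_std[OF assms] by metis
  have "\<pi> casimir = (\<pi> casimir * P) * Q"
    using P by (simp add: assoc_mult_mat[OF rep_carrier[OF rep] P(1,2)] right_mult_one_mat[OF rep_carrier[OF rep]])
  also have "\<dots> = (P * (casimir_value n \<cdot>\<^sub>m 1\<^sub>m n)) * Q"
    by (simp only: int std_casimir)
  also have "\<dots> = casimir_value n \<cdot>\<^sub>m (P * Q)"
    using P by (simp add: mult_smult_distrib[OF P(1) one_carrier_mat] mult_smult_assoc_mat[OF P(1,2)])
  finally show ?thesis by (simp add: P)
qed

lemma irreducible_rep_zero_iff:
  assumes "irreducible_rep n \<pi>"
  shows "\<pi> u = 0\<^sub>m n n \<longleftrightarrow> std n u = 0\<^sub>m n n"
proof -
  have rep: "representation n \<pi>"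
    using assms by (simp add: irreducible_rep_def)
  obtain P Q where P: "P \<in> carrier_mat n n" "Q \<in> carrier_mat n n" "P * Q = 1\<^sub>m n" "Q * P = 1\<^sub>m n"
    and int: "\<pi> u * P = P * std n u"
    using irreducible_rep_equivalent_std[OF assms] by metis
  have "\<pi> u = (P * std n u) * Q"
    using P assoc_mult_mat[OF rep_carrier[OF rep, of u] P(1,2)] right_mult_one_mat[OF rep_carrier[OF rep, of u]]
    by (simp flip: int)
  moreover have "std n u = Q * (\<pi> u * P)"
    using P assoc_mult_mat[OF P(2,1) std_carrier, of u] left_mult_one_mat[OF std_carrier[of n u]]
    by (simp add: int)
  ultimately show ?thesis
    using P by auto
qed

section \<open>Linear dependence over a domain, and membership in spans\<close>

text \<open>Over a field this says that a vector outside the span of \<open>p\<^sub>1, \<dots>, p\<^sub>k\<close> is separated from it by a linear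
  functional. Clearing denominators on both sides gives the statement over an integral domain. The proof avoids
  fractions altogether: one coordinate of \<open>p\<^sub>k\<^sub>+\<^sub>1\<close> serves as a pivot, and the other vectors are reduced by
  cross-multiplication.\<close>

lemma fraction_free_alternative:
  fixes q :: "'s \<Rightarrow> 'r :: idom" and k :: nat
  assumes "finite S"
  shows "(\<exists>z0 z. z0 \<noteq> 0 \<and> (\<forall>s\<in>S. z0 * q s = (\<Sum>i=1..k. z i * p i s))) \<or>
    (\<exists>l. (\<forall>i\<in>{1..k}. (\<Sum>s\<in>S. l s * p i s) = 0) \<and> (\<Sum>s\<in>S. l s * q s) \<noteq> 0)"
  using assms
proof (induction k arbitrary: p q)
  case 0
  show ?case
  proof (cases "\<forall>s\<in>S. q s = 0")
    case True
    then show ?thesis by (intro disjI1 exI[of _ 1]) simp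
  next
    case False
    then obtain s where s: "s \<in> S" "q s \<noteq> 0" by blast
    have "(\<Sum>t\<in>S. (if t = s then 1 else 0) * q t) = q s"
      using s \<open>finite S\<close> by (simp add: if_distrib[of "\<lambda>x. x * _"] cong: if_cong)
    then show ?thesis
      using s by (intro disjI2 exI[of _ "\<lambda>t. if t = s then 1 else 0"]) simp
  qed
next
  case (Suc k)
  define r where "r = p (Suc k)"
  show ?case
  proof (cases "\<forall>s\<in>S. r s = 0")
    case True
    from Suc.IH[OF Suc.prems, of q p] show ?thesis
    proof (elim disjE exE conjE)
      fix z0 z
      assume "z0 \<noteq> 0" "\<forall>s\<in>S. z0 * q s = (\<Sum>i=1..k. z i * p i s)"
      then show ?thesis
        using True by (intro disjI1 exI[of _ z0] exI[of _ z]) (simp add: r_def)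
    next
      fix l
      assume "\<forall>i\<in>{1..k}. (\<Sum>s\<in>S. l s * p i s) = 0" "(\<Sum>s\<in>S. l s * q s) \<noteq> 0"
      then show ?thesis
        using True by (intro disjI2 exI[of _ l]) (auto simp: r_def le_Suc_eq)
    qed
  next
    case False
    then obtain s0 where s0: "s0 \<in> S" "r s0 \<noteq> 0" by blast
    define a where "a = r s0"
    define red where "red = (\<lambda>f s. a * f s - f s0 * r s)"
    from Suc.IH[OF Suc.prems, of "red q" "\<lambda>i. red (p i)"] show ?thesis
    proof (elim disjE exE conjE)
      fix z0 z
      assume z: "z0 \<noteq> 0" "\<forall>s\<in>S. z0 * red q s = (\<Sum>i=1..k. z i * red (p i) s)"
      \<comment> \<open>The last coefficient collects what the reductions of the vectors subtracted.\<close>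
      define z' where "z' = (\<lambda>i. if i = Suc k then z0 * q s0 - (\<Sum>i=1..k. z i * p i s0) else a * z i)"
      have "z0 * a * q s = (\<Sum>i=1..Suc k. z' i * p i s)" if s: "s \<in> S" for s
      proof -
        have "z0 * (a * q s - q s0 * r s) = (\<Sum>i=1..k. z i * (a * p i s - p i s0 * r s))"
          using z(2) s by (simp add: red_def)
        also have "\<dots> = (\<Sum>i=1..k. a * z i * p i s) - (\<Sum>i=1..k. z i * p i s0) * r s"
          by (simp add: right_diff_distrib sum_subtractf sum_distrib_left mult_ac)
        finally have "z0 * a * q s = (\<Sum>i=1..k. a * z i * p i s) + (z0 * q s0 - (\<Sum>i=1..k. z i * p i s0)) * r s"
          by (simp add: algebra_simps)
        also have "\<dots> = (\<Sum>i=1..Suc k. z' i * p i s)"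
          by (simp add: z'_def r_def)
        finally show ?thesis .
      qed
      moreover have "z0 * a \<noteq> 0"
        using z(1) s0 by (simp add: a_def)
      ultimately show ?thesis by blast
    next
      fix l
      assume l: "\<forall>i\<in>{1..k}. (\<Sum>s\<in>S. l s * red (p i) s) = 0" "(\<Sum>s\<in>S. l s * red q s) \<noteq> 0"
      define c where "c = (\<Sum>s\<in>S. l s * r s)"
      \<comment> \<open>Corrected at the pivot position, the functional takes on each vector the value of the old one on its reduction.\<close>
      define l' where "l' = (\<lambda>s. a * l s - (if s = s0 then c else 0))"
      have l': "(\<Sum>s\<in>S. l' s * f s) = (\<Sum>s\<in>S. l s * red f s)" for f
      proof -
        have "(\<Sum>s\<in>S. l' s * f s) = (\<Sum>s\<in>S. a * l s * f s) - (\<Sum>s\<in>S. if s = s0 then c * f s else 0)"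
          by (simp add: l'_def left_diff_distrib sum_subtractf if_distrib[of "\<lambda>x. x * _"] cong: if_cong)
        also have "\<dots> = (\<Sum>s\<in>S. a * l s * f s) - f s0 * (\<Sum>s\<in>S. l s * r s)"
          using s0 \<open>finite S\<close> by (simp add: c_def mult_ac)
        also have "\<dots> = (\<Sum>s\<in>S. l s * red f s)"
          by (simp add: red_def right_diff_distrib sum_subtractf sum_distrib_left mult_ac)
        finally show ?thesis .
      qed
      have "(\<Sum>s\<in>S. l s * red r s) = 0"
        by (simp add: red_def a_def)
      then have "\<forall>i\<in>{1..Suc k}. (\<Sum>s\<in>S. l' s * p i s) = 0"
        unfolding l' using l(1) by (auto simp: r_def le_Suc_eq)
      moreover have "(\<Sum>s\<in>S. l' s * q s) \<noteq> 0"
        unfolding l' by (rule l(2))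
      ultimately show ?thesis by blast
    qed
  qed
qed

text \<open>The coefficients of a linear combination are attached to the indices here, not to the vectors as in the
  definition of the span; the family \<open>g\<close> may repeat vectors.\<close>

lemma (in Module.module) span_image_iff:
  fixes g :: "nat \<Rightarrow> 'c"
  assumes g: "\<And>i. g i \<in> carrier M"
  shows "w \<in> span (g ` {1..k}) \<longleftrightarrow>
    (\<exists>c. (\<forall>i. c i \<in> carrier R) \<and> w = (\<Oplus>\<^bsub>M\<^esub>i\<in>{1..k}. c i \<odot>\<^bsub>M\<^esub> g i))"
proof -
  have gk: "g ` {1..k} \<subseteq> carrier M" for k using g by auto
  have sub: "submodule R (span (g ` {1..k})) M" for k
    by (rule span_is_submodule[OF gk])
  show ?thesis
  proof
    assume "w \<in> span (g ` {1..k})"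
    define L where "L = {v. \<exists>c. (\<forall>i. c i \<in> carrier R) \<and> v = (\<Oplus>\<^bsub>M\<^esub>i\<in>{1..k}. c i \<odot>\<^bsub>M\<^esub> g i)}"
    have "submodule R L M"
    proof (unfold_locales)
      show "L \<subseteq> carrier M"
        using g by (auto simp: L_def intro!: M.finsum_closed)
    next
      fix v w assume "v \<in> L" "w \<in> L"
      then obtain c d where c: "\<And>i. c i \<in> carrier R" "v = (\<Oplus>\<^bsub>M\<^esub>i\<in>{1..k}. c i \<odot>\<^bsub>M\<^esub> g i)"
        and d: "\<And>i. d i \<in> carrier R" "w = (\<Oplus>\<^bsub>M\<^esub>i\<in>{1..k}. d i \<odot>\<^bsub>M\<^esub> g i)"
        by (auto simp: L_def)
      have "v \<oplus>\<^bsub>M\<^esub> w = (\<Oplus>\<^bsub>M\<^esub>i\<in>{1..k}. (c i \<oplus>\<^bsub>R\<^esub> d i) \<odot>\<^bsub>M\<^esub> g i)"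
        using c d g by (simp add: smult_l_distr M.finsum_addf Pi_def)
      then show "v \<oplus>\<^bsub>M\<^esub> w \<in> L"
        unfolding L_def using c(1) d(1) by (auto intro!: exI[of _ "\<lambda>i. c i \<oplus>\<^bsub>R\<^esub> d i"])
    next
      have "(\<Oplus>\<^bsub>M\<^esub>i\<in>{1..k}. \<zero>\<^bsub>R\<^esub> \<odot>\<^bsub>M\<^esub> g i) = \<zero>\<^bsub>M\<^esub>"
        using g by (intro M.finsum_all0) auto
      then show "\<zero>\<^bsub>M\<^esub> \<in> L"
        unfolding L_def by (auto intro!: exI[of _ "\<lambda>i. \<zero>\<^bsub>R\<^esub>"])
    next
      fix a v assume a: "a \<in> carrier R" and "v \<in> L"
      then obtain c where c: "\<And>i. c i \<in> carrier R" "v = (\<Oplus>\<^bsub>M\<^esub>i\<in>{1..k}. c i \<odot>\<^bsub>M\<^esub> g i)"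
        by (auto simp: L_def)
      have "a \<odot>\<^bsub>M\<^esub> v = (\<Oplus>\<^bsub>M\<^esub>i\<in>{1..k}. (a \<otimes>\<^bsub>R\<^esub> c i) \<odot>\<^bsub>M\<^esub> g i)"
        using a c g by (simp add: finsum_smult smult_assoc1 Pi_def)
      then show "a \<odot>\<^bsub>M\<^esub> v \<in> L"
        unfolding L_def using c(1) a by (auto intro!: exI[of _ "\<lambda>i. a \<otimes>\<^bsub>R\<^esub> c i"])
    qed
    moreover have "g ` {1..k} \<subseteq> L"
    proof
      fix v assume "v \<in> g ` {1..k}"
      then obtain j where j: "j \<in> {1..k}" "v = g j" by blast
      have "(\<Oplus>\<^bsub>M\<^esub>i\<in>{1..k}. (if j = i then \<one>\<^bsub>R\<^esub> else \<zero>\<^bsub>R\<^esub>) \<odot>\<^bsub>M\<^esub> g i) =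
          (\<Oplus>\<^bsub>M\<^esub>i\<in>{1..k}. if j = i then g i else \<zero>\<^bsub>M\<^esub>)"
        using g by (intro M.finsum_cong') auto
      also have "\<dots> = v"
        using j g by (subst M.finsum_singleton) auto
      finally show "v \<in> L"
        unfolding L_def by (auto intro!: exI[of _ "\<lambda>i. if j = i then \<one>\<^bsub>R\<^esub> else \<zero>\<^bsub>R\<^esub>"])
    qed
    ultimately have "span (g ` {1..k}) \<subseteq> L"
      by (intro span_is_subset)
    then show "\<exists>c. (\<forall>i. c i \<in> carrier R) \<and> w = (\<Oplus>\<^bsub>M\<^esub>i\<in>{1..k}. c i \<odot>\<^bsub>M\<^esub> g i)"
      using \<open>w \<in> span (g ` {1..k})\<close> by (auto simp: L_def)
  next
    assume "\<exists>c. (\<forall>i. c i \<in> carrier R) \<and> w = (\<Oplus>\<^bsub>M\<^esub>i\<in>{1..k}. c i \<odot>\<^bsub>M\<^esub> g i)"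
    then obtain c where c: "\<And>i. c i \<in> carrier R" "w = (\<Oplus>\<^bsub>M\<^esub>i\<in>{1..k}. c i \<odot>\<^bsub>M\<^esub> g i)"
      by blast
    define T where "T = span (g ` {1..k})"
    interpret N: submodule R T M unfolding T_def by (rule sub)
    have gi: "g i \<in> T" if "i \<in> {1..k}" for i
      using in_own_span[OF gk] that unfolding T_def by blast
    have "(\<Oplus>\<^bsub>M\<^esub>i\<in>A. c i \<odot>\<^bsub>M\<^esub> g i) \<in> T" if "A \<subseteq> {1..k}" for A
      using finite_subset[OF that finite_atLeastAtMost] that
      by (induction A rule: finite_induct) (use c(1) g gi in \<open>auto simp: Pi_def\<close>)
    then show "w \<in> span (g ` {1..k})" using c(2) unfolding T_def by blast
  qed
qed

lemma span_vec_iff: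
  fixes g :: "nat \<Rightarrow> complex vec"
  assumes g: "\<And>i. g i \<in> carrier_vec n" and w: "w \<in> carrier_vec n"
  shows "w \<in> LinearCombinations.module.span class_ring (module_vec TYPE(complex) n) (g ` {1..k}) \<longleftrightarrow>
    (\<exists>c. \<forall>j<n. w $ j = (\<Sum>i=1..k. c i * g i $ j))"
proof -
  interpret V: Module.module "class_ring :: complex ring" "module_vec TYPE(complex) n"
    by (rule vec_module)
  have fin: "(\<Oplus>\<^bsub>module_vec TYPE(complex) n\<^esub>i\<in>A. c i \<cdot>\<^sub>v g i) \<in> carrier_vec n \<and>
      (\<forall>j<n. (\<Oplus>\<^bsub>module_vec TYPE(complex) n\<^esub>i\<in>A. c i \<cdot>\<^sub>v g i) $ j = (\<Sum>i\<in>A. c i * g i $ j))"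
    if "finite A" for c :: "nat \<Rightarrow> complex" and A
    using that
  proof (induction A rule: finite_induct)
    case (insert i A)
    have "(\<lambda>i. c i \<cdot>\<^sub>v g i) \<in> A \<rightarrow> carrier (module_vec TYPE(complex) n)"
      using g by (auto simp: module_vec_simps)
    then have "(\<Oplus>\<^bsub>module_vec TYPE(complex) n\<^esub>i\<in>insert i A. c i \<cdot>\<^sub>v g i) =
        c i \<cdot>\<^sub>v g i + (\<Oplus>\<^bsub>module_vec TYPE(complex) n\<^esub>i\<in>A. c i \<cdot>\<^sub>v g i)"
      using insert g by (subst V.M.finsum_insert) (auto simp: module_vec_simps)
    then show ?case using insert g[of i] by auto
  qed (simp add: module_vec_simps)
  have "w \<in> V.span (g ` {1..k}) \<longleftrightarrow>
      (\<exists>c. w = (\<Oplus>\<^bsub>module_vec TYPE(complex) n\<^esub>i\<in>{1..k}. c i \<cdot>\<^sub>v g i))"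
    using V.span_image_iff[of g w k] g by (simp add: module_vec_simps)
  also have "\<dots> \<longleftrightarrow> (\<exists>c. \<forall>j<n. w $ j = (\<Sum>i=1..k. c i * g i $ j))"
  proof (intro ex_cong1 iffI)
    fix c
    assume "\<forall>j<n. w $ j = (\<Sum>i=1..k. c i * g i $ j)"
    then show "w = (\<Oplus>\<^bsub>module_vec TYPE(complex) n\<^esub>i\<in>{1..k}. c i \<cdot>\<^sub>v g i)"
      using fin[of "{1..k}" c] w by (intro eq_vecI) auto
  qed (use fin[of "{1..k}"] in simp)
  finally show ?thesis .
qed

lemma span_mat_iff:
  fixes g :: "nat \<Rightarrow> complex mat"
  assumes g: "\<And>i. g i \<in> carrier_mat n n" and w: "w \<in> carrier_mat n n"
  shows "w \<in> LinearCombinations.module.span class_ring (module_mat TYPE(complex) n n) (g ` {1..k}) \<longleftrightarrow>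
    (\<exists>c. \<forall>a<n. \<forall>b<n. w $$ (a, b) = (\<Sum>i=1..k. c i * g i $$ (a, b)))"
proof -
  interpret V: Module.module "class_ring :: complex ring" "module_mat TYPE(complex) n n"
    using matrix_vs[where 'a = complex, of n n] by (simp add: vectorspace_def)
  have fin: "(\<Oplus>\<^bsub>module_mat TYPE(complex) n n\<^esub>i\<in>A. c i \<cdot>\<^sub>m g i) \<in> carrier_mat n n \<and>
      (\<forall>a<n. \<forall>b<n. (\<Oplus>\<^bsub>module_mat TYPE(complex) n n\<^esub>i\<in>A. c i \<cdot>\<^sub>m g i) $$ (a, b) = (\<Sum>i\<in>A. c i * g i $$ (a, b)))"
    if "finite A" for c :: "nat \<Rightarrow> complex" and A
    using that
  proof (induction A rule: finite_induct)
    case (insert i A)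
    have "(\<lambda>i. c i \<cdot>\<^sub>m g i) \<in> A \<rightarrow> carrier (module_mat TYPE(complex) n n)"
      using g by (auto simp: module_mat_simps)
    then have "(\<Oplus>\<^bsub>module_mat TYPE(complex) n n\<^esub>i\<in>insert i A. c i \<cdot>\<^sub>m g i) =
        c i \<cdot>\<^sub>m g i + (\<Oplus>\<^bsub>module_mat TYPE(complex) n n\<^esub>i\<in>A. c i \<cdot>\<^sub>m g i)"
      using insert g by (subst V.M.finsum_insert) (auto simp: module_mat_simps)
    then show ?case using insert g[of i] by auto
  qed (simp add: module_mat_simps)
  have "w \<in> V.span (g ` {1..k}) \<longleftrightarrow>
      (\<exists>c. w = (\<Oplus>\<^bsub>module_mat TYPE(complex) n n\<^esub>i\<in>{1..k}. c i \<cdot>\<^sub>m g i))"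
    using V.span_image_iff[of g w k] g by (simp add: module_mat_simps)
  also have "\<dots> \<longleftrightarrow> (\<exists>c. \<forall>a<n. \<forall>b<n. w $$ (a, b) = (\<Sum>i=1..k. c i * g i $$ (a, b)))"
  proof (intro ex_cong1 iffI)
    fix c
    assume "\<forall>a<n. \<forall>b<n. w $$ (a, b) = (\<Sum>i=1..k. c i * g i $$ (a, b))"
    then show "w = (\<Oplus>\<^bsub>module_mat TYPE(complex) n n\<^esub>i\<in>{1..k}. c i \<cdot>\<^sub>m g i)"
      using fin[of "{1..k}" c] w by (intro eq_matI) auto
  qed (use fin[of "{1..k}"] in simp)
  finally show ?thesis .
qed

section \<open>The three implications\<close>

lemma casimir_value_inj: "inj casimir_value"
proof (rule injI)
  fix m n assume "casimir_value m = casimir_value n"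
  then have "of_nat (m ^ 2) = (of_nat (n ^ 2) :: complex)"
    by (simp add: casimir_value_def)
  then show "m = n"
    by (simp only: of_nat_eq_iff power2_eq_iff_nonneg)
qed

text \<open>A nonzero polynomial has finitely many roots, whereas the values \<open>c\<^sub>n\<close> are pairwise distinct.\<close>

lemma casimir_value_nonroot:
  assumes "z \<noteq> 0"
  obtains n where "n \<ge> m" "poly z (casimir_value n) \<noteq> 0"
proof -
  have "infinite (casimir_value ` {m..})"
    using finite_imageD[of casimir_value "{m..}"] casimir_value_inj infinite_Ici[of m]
    by (metis inj_on_subset subset_UNIV)
  moreover have "finite {x. poly z x = 0}"
    using assms by (rule poly_roots_finite)
  ultimately have "\<not> casimir_value ` {m..} \<subseteq> {x. poly z x = 0}"
    using finite_subset by blast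
  then show ?thesis using that by auto
qed

lemma std_poly_casimir: "std n (poly_casimir z * u) = poly z (casimir_value n) \<cdot>\<^sub>m std n u"
  by (rule rep_poly_casimir[OF representation_std std_casimir])

lemma poly_casimir_nonzero:
  assumes "z \<noteq> 0"
  shows "poly_casimir z \<noteq> 0"
proof
  assume 0: "poly_casimir z = 0"
  obtain n where n: "n \<ge> 1" "poly z (casimir_value n) \<noteq> 0"
    using casimir_value_nonroot[OF assms] .
  have "std n (poly_casimir z * 1) $$ (0, 0) = poly z (casimir_value n)"
    using n(1) by (simp only: std_poly_casimir std_one) simp
  then show False
    using n by (simp add: 0 rep_zero[OF representation_std])
qed

text \<open>The entry at \<open>(i, j)\<close> sees only the part of degree \<open>e = i - j\<close>. Up to a factor that is not zero, it is the value at
  the weight \<open>n - 1 - 2 j\<close> of a polynomial of degree at most \<open>N\<close>.\<close>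

lemma std_expansion_index:
  assumes u: "u = (\<Sum>s\<in>box N. poly_casimir (F s) * pbw s)" and ij: "i < n" "j < n"
  shows "std n u $$ (i, j) =
    (if \<bar>int i - int j\<bar> \<le> int N
     then std n (weight_op (int i - int j)) $$ (i, j) *
       (\<Sum>b\<le>N. poly (F (int i - int j, b)) (casimir_value n) * (of_nat n - 1 - 2 * of_nat j) ^ b)
     else 0)"
proof -
  let ?h = "of_nat n - 1 - 2 * of_nat j :: complex"
  let ?f = "\<lambda>e b. poly (F (e, b)) (casimir_value n) * ?h ^ b"
  have "std n u $$ (i, j) = (\<Sum>s\<in>box N. std n (poly_casimir (F s) * pbw s) $$ (i, j))"
    unfolding u by (rule rep_sum_index[OF representation_std ij])
  also have "\<dots> = (\<Sum>(e, b)\<in>box N. std n (weight_op e) $$ (i, j) * ?f e b)"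
    using ij by (intro sum.cong)
      (auto simp: std_poly_casimir pbw_def std_UH_power_right_index simp del: index_mult_mat)
  also have "\<dots> = (\<Sum>e\<in>{- int N..int N}. std n (weight_op e) $$ (i, j) * (\<Sum>b\<le>N. ?f e b))"
    by (simp add: box_def sum_distrib_left flip: sum.cartesian_product)
  also have "\<dots> = (\<Sum>e\<in>{- int N..int N}. if e = int i - int j
      then std n (weight_op e) $$ (i, j) * (\<Sum>b\<le>N. ?f e b) else 0)"
  proof -
    have "std n (weight_op e) $$ (i, j) = 0" if "e \<noteq> int i - int j" for e
      using std_weight_op_index[OF ij, of e] that by blast
    then show ?thesis by (intro sum.cong) auto
  qed
  also have "\<dots> = (if \<bar>int i - int j\<bar> \<le> int N
      then std n (weight_op (int i - int j)) $$ (i, j) * (\<Sum>b\<le>N. ?f (int i - int j) b) else 0)"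
    by (simp add: abs_le_iff)
  finally show ?thesis .
qed

text \<open>The distance \<open>2 N + 1\<close> keeps apart the windows of radius \<open>N\<close> around different positions, and the offset \<open>N\<close>
  leaves room for the first window. There are \<open>N + 1\<close> positions, one more than the degree of the polynomials that
  are tested.\<close>

definition test_position :: "nat \<Rightarrow> nat \<Rightarrow> nat" where
  "test_position N t = N + (2 * N + 1) * t"

definition test_vec :: "nat \<Rightarrow> nat \<Rightarrow> complex vec" where
  "test_vec n N = vec n (\<lambda>j. if j \<in> test_position N ` {..N} then 1 else 0)"

lemma test_position_less:
  assumes "t \<le> N" "n \<ge> (2 * N + 1) * (N + 1)"
  shows "test_position N t + N < n"
proof -
  have "(2 * N + 1) * t \<le> (2 * N + 1) * N"
    by (intro mult_le_mono2 assms(1))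
  then have "test_position N t + N \<le> N + (2 * N + 1) * N + N"
    by (simp add: test_position_def)
  also have "\<dots> < (2 * N + 1) * (N + 1)"
    by (simp add: algebra_simps)
  finally show ?thesis using assms(2) by (rule less_le_trans)
qed

lemma test_position_separated:
  assumes "t \<noteq> t'"
  shows "\<bar>int (test_position N t) - int (test_position N t')\<bar> > 2 * int N"
proof -
  have "int (test_position N t) - int (test_position N t') = (2 * int N + 1) * (int t - int t')"
    by (simp add: test_position_def algebra_simps)
  then have eq: "\<bar>int (test_position N t) - int (test_position N t')\<bar> = (2 * int N + 1) * \<bar>int t - int t'\<bar>"
    by (simp only: abs_mult)
  have "2 * int N < (2 * int N + 1) * 1"
    by simp
  also have "\<dots> \<le> (2 * int N + 1) * \<bar>int t - int t'\<bar>"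
    using assms by (intro mult_left_mono) auto
  finally show ?thesis
    by (simp only: eq)
qed

lemma test_position_inj: "inj_on (test_position N) A"
proof (rule inj_onI, rule ccontr)
  fix x y assume "test_position N x = test_position N y" "x \<noteq> y"
  then show False using test_position_separated[of x y N] by simp
qed

text \<open>For each degree \<open>e\<close>, the coordinates of \<open>u v\<close> at distance \<open>e\<close> from the test positions involve one
  basis vector each. If they vanish, the polynomial formed by the coefficients of degree \<open>e\<close> has \<open>N + 1\<close> distinct
  roots and degree at most \<open>N\<close>.\<close>

lemma test_vec_detects_coefficients:
  assumes u: "u = (\<Sum>s\<in>box N. poly_casimir (F s) * pbw s)"
    and n: "n \<ge> (2 * N + 1) * (N + 1)"
    and zero: "std n u *\<^sub>v test_vec n N = 0\<^sub>v n"
    and s: "s \<in> box N"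
  shows "poly (F s) (casimir_value n) = 0"
proof -
  obtain e b where eb: "s = (e, b)" "\<bar>e\<bar> \<le> int N" "b \<le> N"
    using s by (cases s) (auto simp: box_def)
  let ?c = "casimir_value n"
  define g where "g = (\<Sum>b\<le>N. monom (poly (F (e, b)) ?c) b)"
  define h where "h = (\<lambda>t. of_nat n - 1 - 2 * of_nat (test_position N t) :: complex)"
  have root: "poly g (h t) = 0" if t: "t \<le> N" for t
  proof -
    let ?d = "test_position N t"
    define i where "i = nat (int ?d + e)"
    have "int N \<le> int ?d"
      by (simp add: test_position_def)
    then have i: "int i = int ?d + e"
      using eb(2) by (simp add: i_def)
    have d: "?d + N < n"
      by (rule test_position_less[OF t n])
    then have "i < n" "?d < n"
      using i eb(2) by linarith+
    have "0 = (std n u *\<^sub>v test_vec n N) $ i"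
      using \<open>i < n\<close> by (simp only: zero index_zero_vec)
    also have "\<dots> = (\<Sum>j<n. std n u $$ (i, j) * (if j \<in> test_position N ` {..N} then 1 else 0))"
      using \<open>i < n\<close> by (simp add: test_vec_def scalar_prod_def atLeast0LessThan)
    also have "\<dots> = (\<Sum>j<n. if j = ?d then std n u $$ (i, j) else 0)"
    proof (rule sum.cong[OF refl])
      fix j assume j: "j \<in> {..<n}"
      show "std n u $$ (i, j) * (if j \<in> test_position N ` {..N} then 1 else 0) =
          (if j = ?d then std n u $$ (i, j) else 0)"
      proof (cases "j \<in> test_position N ` {..N} \<and> j \<noteq> ?d")
        case True
        then obtain t' where t': "j = test_position N t'" "t' \<noteq> t" by auto
        have "\<not> \<bar>int i - int j\<bar> \<le> int N"
        proof -
          have "\<bar>int ?d - int j\<bar> > 2 * int N"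
            using test_position_separated[OF t'(2)[symmetric], of N] t'(1) by simp
          moreover have "\<bar>(int i - int j) - e\<bar> \<le> \<bar>int i - int j\<bar> + \<bar>e\<bar>"
            by (rule abs_triangle_ineq4)
          moreover have "(int i - int j) - e = int ?d - int j"
            using i by simp
          ultimately show ?thesis using eb(2) by linarith
        qed
        then have "std n u $$ (i, j) = 0"
          using std_expansion_index[OF u \<open>i < n\<close>, of j] j by simp
        then show ?thesis using True by simp
      next
        case False
        have "?d \<in> test_position N ` {..N}"
          using t by simp
        then show ?thesis
          using False by (cases "j = ?d") simp_all
      qed
    qed
    also have "\<dots> = std n u $$ (i, ?d)"
      using \<open>?d < n\<close> by simp
    also have "\<dots> = std n (weight_op e) $$ (i, ?d) * (\<Sum>b\<le>N. poly (F (e, b)) ?c * h t ^ b)"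
      using eb(2) i by (simp add: std_expansion_index[OF u \<open>i < n\<close> \<open>?d < n\<close>] h_def)
    finally have "(\<Sum>b\<le>N. poly (F (e, b)) ?c * h t ^ b) = 0"
      using std_weight_op_index[OF \<open>i < n\<close> \<open>?d < n\<close>, of e] i by simp
    then show ?thesis
      by (simp add: g_def poly_sum poly_monom)
  qed
  have "g = 0"
  proof (rule ccontr)
    assume "g \<noteq> 0"
    have "inj_on h {..N}"
      by (rule inj_onI) (auto simp: h_def dest: inj_onD[OF test_position_inj])
    then have "N + 1 = card (h ` {..N})"
      by (simp add: card_image)
    also have "\<dots> \<le> card {x. poly g x = 0}"
      using root \<open>g \<noteq> 0\<close> by (intro card_mono poly_roots_finite) auto
    also have "\<dots> \<le> degree g"
      using \<open>g \<noteq> 0\<close> by (rule card_poly_roots_bound)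
    also have "\<dots> \<le> N"
      unfolding g_def by (intro degree_sum_le order_trans[OF degree_monom_le]) auto
    finally show False by simp
  qed
  then have "coeff g b = 0" by simp
  then show ?thesis
    using eb by (simp add: g_def coeff_sum)
qed

lemma rep_sum_vec_index:
  assumes rep: "representation n \<pi>" and v: "v \<in> carrier_vec n" and a: "a < n"
  shows "(\<pi> (sum f A) *\<^sub>v v) $ a = (\<Sum>x\<in>A. (\<pi> (f x) *\<^sub>v v) $ a)"
proof (induction A rule: infinite_finite_induct)
  case (insert x A)
  then show ?case
    using a rep_vec_carrier[OF rep, of "f x" v] rep_vec_carrier[OF rep, of "sum f A" v]
    by (simp add: rep_add_vec[OF rep v] dim_rep[OF rep] del: index_mult_mat_vec)
qed (use a v in \<open>simp_all add: rep_zero[OF rep]\<close>)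

lemma in_Loc_irreps_iff:
  fixes p :: "nat \<Rightarrow> Usl2"
  shows "q \<in> Loc irreps (p ` {1..k}) \<longleftrightarrow> (\<forall>n \<pi>. irreducible_rep n \<pi> \<longrightarrow>
     (\<exists>c. \<forall>a<n. \<forall>b<n. \<pi> q $$ (a, b) = (\<Sum>i=1..k. c i * \<pi> (p i) $$ (a, b))))"
proof -
  have "\<pi> q \<in> LinearCombinations.module.span class_ring (module_mat TYPE(complex) n n) (\<pi> ` p ` {1..k}) \<longleftrightarrow>
      (\<exists>c. \<forall>a<n. \<forall>b<n. \<pi> q $$ (a, b) = (\<Sum>i=1..k. c i * \<pi> (p i) $$ (a, b)))"
    if "irreducible_rep n \<pi>" for n \<pi>
    unfolding image_image
    by (rule span_mat_iff) (use that in \<open>simp_all add: irreducible_rep_def rep_carrier\<close>)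
  then show ?thesis
    unfolding Loc_def irreps_def by auto
qed

lemma in_Ref_irreps_iff:
  fixes p :: "nat \<Rightarrow> Usl2"
  shows "q \<in> Ref irreps (p ` {1..k}) \<longleftrightarrow> (\<forall>n \<pi>. irreducible_rep n \<pi> \<longrightarrow> (\<forall>v\<in>carrier_vec n.
     \<exists>c. \<forall>a<n. (\<pi> q *\<^sub>v v) $ a = (\<Sum>i=1..k. c i * (\<pi> (p i) *\<^sub>v v) $ a)))"
proof -
  have "\<pi> q *\<^sub>v v \<in> LinearCombinations.module.span class_ring (module_vec TYPE(complex) n)
        ((\<lambda>x. \<pi> x *\<^sub>v v) ` p ` {1..k}) \<longleftrightarrow>
      (\<exists>c. \<forall>a<n. (\<pi> q *\<^sub>v v) $ a = (\<Sum>i=1..k. c i * (\<pi> (p i) *\<^sub>v v) $ a))"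
    if "irreducible_rep n \<pi>" for n \<pi> v
    unfolding image_image
    by (rule span_vec_iff) (use that in \<open>simp_all add: irreducible_rep_def rep_vec_carrier\<close>)
  then show ?thesis
    unfolding Ref_def irreps_def by auto
qed

text \<open>The standard representation witnesses the choice in the definition of \<open>rho\<close>.\<close>

lemma irreducible_rho: "n \<ge> 1 \<Longrightarrow> irreducible_rep n (rho n)"
  unfolding rho_def by (rule someI[of "irreducible_rep n"]) (rule irreducible_std)

text \<open>Where \<open>q\<close> acts as zero there is nothing to prove; this may be tested on \<open>rho n\<close>, since equivalent
  representations have the same kernel. Elsewhere \<open>z\<^sub>0\<close> acts by a scalar that can be inverted.\<close>

lemma central_combination_imp_Loc:
  fixes p :: "nat \<Rightarrow> Usl2"
  assumes cc: "central_combination k p q z" and nv: "nonvanishing_where_nonzero q (z 0)"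
  shows "q \<in> Loc irreps (p ` {1..k})"
  unfolding in_Loc_irreps_iff
proof (intro allI impI)
  fix n \<pi> assume irr: "irreducible_rep n \<pi>"
  then have rep: "representation n \<pi>" and n: "n \<ge> 1"
    by (auto simp: irreducible_rep_def)
  let ?c = "casimir_value n"
  note pc = rep_poly_casimir[OF rep irreducible_rep_casimir[OF irr]]
  show "\<exists>c. \<forall>a<n. \<forall>b<n. \<pi> q $$ (a, b) = (\<Sum>i=1..k. c i * \<pi> (p i) $$ (a, b))"
  proof (cases "\<pi> q = 0\<^sub>m n n")
    case True
    then show ?thesis by (intro exI[of _ "\<lambda>_. 0"]) simp
  next
    case False
    have "irreducible_rep n (rho n)"
      by (rule irreducible_rho[OF n])
    then have "rho n q \<noteq> 0\<^sub>m n n"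
      using False irreducible_rep_zero_iff[OF irr] irreducible_rep_zero_iff by blast
    then have z0: "poly (z 0) ?c \<noteq> 0"
      using nv n by (simp add: nonvanishing_where_nonzero_def)
    have "\<pi> q $$ (a, b) = (\<Sum>i=1..k. poly (z i) ?c / poly (z 0) ?c * \<pi> (p i) $$ (a, b))"
      if ab: "a < n" "b < n" for a b
    proof -
      have "poly (z 0) ?c * \<pi> q $$ (a, b) = \<pi> (poly_casimir (z 0) * q) $$ (a, b)"
        using ab by (simp add: pc dim_rep[OF rep])
      also have "\<dots> = (\<Sum>i=1..k. poly (z i) ?c * \<pi> (p i) $$ (a, b))"
        using cc ab by (simp add: central_combination_def rep_sum_index[OF rep] pc dim_rep[OF rep])
      finally have "\<pi> q $$ (a, b) = (\<Sum>i=1..k. poly (z i) ?c * \<pi> (p i) $$ (a, b)) / poly (z 0) ?c"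
        using z0 by (simp add: field_simps)
      then show ?thesis by (simp add: sum_divide_distrib)
    qed
    then show ?thesis
      by (intro exI[of _ "\<lambda>i. poly (z i) ?c / poly (z 0) ?c"]) blast
  qed
qed

lemma Loc_imp_Ref:
  fixes p :: "nat \<Rightarrow> Usl2"
  assumes "q \<in> Loc irreps (p ` {1..k})"
  shows "q \<in> Ref irreps (p ` {1..k})"
  unfolding in_Ref_irreps_iff
proof (intro allI impI ballI)
  fix n \<pi> and v :: "complex vec"
  assume irr: "irreducible_rep n \<pi>" and v: "v \<in> carrier_vec n"
  then have rep: "representation n \<pi>"
    by (auto simp: irreducible_rep_def)
  obtain c where c: "\<And>a b. a < n \<Longrightarrow> b < n \<Longrightarrow> \<pi> q $$ (a, b) = (\<Sum>i=1..k. c i * \<pi> (p i) $$ (a, b))"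
    using assms irr unfolding in_Loc_irreps_iff by metis
  have index: "(\<pi> u *\<^sub>v v) $ a = (\<Sum>b<n. \<pi> u $$ (a, b) * v $ b)" if "a < n" for u a
    using that v by (simp add: dim_rep[OF rep] scalar_prod_def atLeast0LessThan)
  have "(\<pi> q *\<^sub>v v) $ a = (\<Sum>i=1..k. c i * (\<pi> (p i) *\<^sub>v v) $ a)" if a: "a < n" for a
  proof -
    have "(\<pi> q *\<^sub>v v) $ a = (\<Sum>b<n. \<Sum>i=1..k. c i * \<pi> (p i) $$ (a, b) * v $ b)"
      using a by (simp add: index c sum_distrib_right del: index_mult_mat_vec)
    also have "\<dots> = (\<Sum>i=1..k. \<Sum>b<n. c i * \<pi> (p i) $$ (a, b) * v $ b)"
      by (rule sum.swap)
    also have "\<dots> = (\<Sum>i=1..k. c i * (\<pi> (p i) *\<^sub>v v) $ a)"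
      using a by (simp add: index sum_distrib_left mult.assoc del: index_mult_mat_vec)
    finally show ?thesis .
  qed
  then show "\<exists>c. \<forall>a<n. (\<pi> q *\<^sub>v v) $ a = (\<Sum>i=1..k. c i * (\<pi> (p i) *\<^sub>v v) $ a)"
    by (intro exI[of _ c]) blast
qed

lemma common_pbw_expansion:
  assumes "finite A"
  shows "\<exists>N F. \<forall>u\<in>A. u = (\<Sum>s\<in>box N. poly_casimir (F u s) * pbw s)"
proof -
  obtain N F where NF: "\<And>u M. M \<ge> N u \<Longrightarrow> u = (\<Sum>s\<in>box M. poly_casimir (F u s) * pbw s)"
    using pbw_expansion by metis
  show ?thesis
  proof (intro exI ballI)
    fix u assume "u \<in> A"
    then show "u = (\<Sum>s\<in>box (Max (N ` A)). poly_casimir (F u s) * pbw s)"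
      using assms by (intro NF Max_ge) auto
  qed
qed

text \<open>If no central relation exists, the separating functional \<open>l\<close> contradicts the relation with constant
  coefficients that membership in \<open>Ref\<close> yields for the test vector in a suitable large dimension.\<close>

lemma Ref_imp_central_combination:
  fixes p :: "nat \<Rightarrow> Usl2"
  assumes ref: "q \<in> Ref irreps (p ` {1..k})"
  shows "\<exists>z. central_combination k p q z"
proof -
  obtain N F where F: "\<And>u. u \<in> insert q (p ` {1..k}) \<Longrightarrow> u = (\<Sum>s\<in>box N. poly_casimir (F u s) * pbw s)"
    using common_pbw_expansion[of "insert q (p ` {1..k})"] by blast
  have Fq: "q = (\<Sum>s\<in>box N. poly_casimir (F q s) * pbw s)"
    by (rule F) simp
  have Fp: "p i = (\<Sum>s\<in>box N. poly_casimir (F (p i) s) * pbw s)" if "i \<in> {1..k}" for i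
    using that by (intro F) blast
  consider (relation) z0 z where "z0 \<noteq> 0" "\<forall>s\<in>box N. z0 * F q s = (\<Sum>i=1..k. z i * F (p i) s)"
    | (functional) l where "\<forall>i\<in>{1..k}. (\<Sum>s\<in>box N. l s * F (p i) s) = 0" "(\<Sum>s\<in>box N. l s * F q s) \<noteq> 0"
    using fraction_free_alternative[OF finite_box, where q = "F q" and k = k and p = "\<lambda>i. F (p i)"] by blast
  then show ?thesis
  proof cases
    case relation
    define Z where "Z = (\<lambda>i. if i = 0 then z0 else z i)"
    have "poly_casimir z0 * q = (\<Sum>s\<in>box N. poly_casimir (z0 * F q s) * pbw s)"
      by (subst Fq) (simp add: sum_distrib_left poly_casimir_mult mult.assoc)
    also have "\<dots> = (\<Sum>s\<in>box N. \<Sum>i=1..k. poly_casimir (z i) * (poly_casimir (F (p i) s) * pbw s))"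
      using relation(2)
      by (intro sum.cong) (auto simp: poly_casimir_sum poly_casimir_mult sum_distrib_right mult.assoc)
    also have "\<dots> = (\<Sum>i=1..k. poly_casimir (z i) * (\<Sum>s\<in>box N. poly_casimir (F (p i) s) * pbw s))"
      by (subst sum.swap) (simp add: sum_distrib_left)
    also have "\<dots> = (\<Sum>i=1..k. poly_casimir (Z i) * p i)"
      using Fp by (intro sum.cong) (auto simp: Z_def)
    finally have "central_combination k p q Z"
      using relation(1) by (simp add: central_combination_def Z_def poly_casimir_nonzero)
    then show ?thesis by blast
  next
    case functional
    obtain n where n: "n \<ge> (2 * N + 1) * (N + 1)"
      and nz: "poly (\<Sum>s\<in>box N. l s * F q s) (casimir_value n) \<noteq> 0"
      using casimir_value_nonroot[OF functional(2)] .
    let ?c = "casimir_value n" and ?v = "test_vec n N"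
    have v: "?v \<in> carrier_vec n"
      by (simp add: test_vec_def)
    have "1 \<le> (2 * N + 1) * (N + 1)"
      by simp
    then have "n \<ge> 1"
      using n by (rule order_trans)
    then have "\<exists>c. \<forall>a<n. (std n q *\<^sub>v ?v) $ a = (\<Sum>i=1..k. c i * (std n (p i) *\<^sub>v ?v) $ a)"
      using ref irreducible_std v unfolding in_Ref_irreps_iff by blast
    then obtain c where c: "\<And>a. a < n \<Longrightarrow> (std n q *\<^sub>v ?v) $ a = (\<Sum>i=1..k. c i * (std n (p i) *\<^sub>v ?v) $ a)"
      by blast
    define u where "u = q - (\<Sum>i=1..k. c i *\<^sub>U p i)"
    define G where "G = (\<lambda>s. F q s - (\<Sum>i=1..k. Polynomial.smult (c i) (F (p i) s)))"
    have "u = (\<Sum>s\<in>box N. poly_casimir (G s) * pbw s)"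
    proof -
      have pcd: "poly_casimir (x - y) = poly_casimir x - poly_casimir y" for x y
        using poly_casimir_add[of "x - y" y] by simp
      have "(\<Sum>i=1..k. c i *\<^sub>U p i) = (\<Sum>i=1..k. \<Sum>s\<in>box N. c i *\<^sub>U (poly_casimir (F (p i) s) * pbw s))"
        using Fp by (intro sum.cong refl) (metis scaleU.scale_sum_right)
      also have "\<dots> = (\<Sum>s\<in>box N. \<Sum>i=1..k. c i *\<^sub>U (poly_casimir (F (p i) s) * pbw s))"
        by (rule sum.swap)
      finally show ?thesis
        unfolding u_def G_def
        by (subst Fq) (simp add: pcd left_diff_distrib sum_subtractf poly_casimir_sum
            sum_distrib_right poly_casimir_smult scaleU_mult_left)
    qed
    moreover have "std n u *\<^sub>v ?v = 0\<^sub>v n"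
    proof (rule eq_vecI)
      fix a assume "a < dim_vec (0\<^sub>v n :: complex vec)"
      then have a: "a < n" by simp
      note R = representation_std[of n]
      have "(std n u *\<^sub>v ?v) $ a = (std n q *\<^sub>v ?v) $ a - (std n (\<Sum>i=1..k. c i *\<^sub>U p i) *\<^sub>v ?v) $ a"
        using a rep_vec_carrier[OF R]
        by (simp add: u_def rep_diff_vec[OF R v] del: index_mult_mat_vec)
      also have "(std n (\<Sum>i=1..k. c i *\<^sub>U p i) *\<^sub>v ?v) $ a = (\<Sum>i=1..k. c i * (std n (p i) *\<^sub>v ?v) $ a)"
        using a rep_vec_carrier[OF R]
        by (simp add: rep_sum_vec_index[OF R v a] rep_scale_vec[OF R v] del: index_mult_mat_vec)
      finally show "(std n u *\<^sub>v ?v) $ a = 0\<^sub>v n $ a"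
        using a by (simp add: c del: index_mult_mat_vec)
    qed simp
    ultimately have "poly (G s) ?c = 0" if "s \<in> box N" for s
      using test_vec_detects_coefficients[OF _ n _ that] by blast
    then have G: "poly (F q s) ?c = (\<Sum>i=1..k. c i * poly (F (p i) s) ?c)" if "s \<in> box N" for s
      using that by (simp add: G_def poly_sum)
    have "poly (\<Sum>s\<in>box N. l s * F q s) ?c = (\<Sum>s\<in>box N. \<Sum>i=1..k. c i * poly (l s * F (p i) s) ?c)"
      by (simp add: poly_sum G sum_distrib_left mult_ac)
    also have "\<dots> = (\<Sum>i=1..k. \<Sum>s\<in>box N. c i * poly (l s * F (p i) s) ?c)"
      by (rule sum.swap)
    also have "\<dots> = (\<Sum>i=1..k. c i * poly (\<Sum>s\<in>box N. l s * F (p i) s) ?c)"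
      by (simp add: poly_sum sum_distrib_left)
    also have "\<dots> = 0"
      using functional(1) by simp
    finally show ?thesis using nz by simp
  qed
qed

section \<open>The failing converses\<close>

lemma casimir_value_eq_iff: "casimir_value m = casimir_value n \<longleftrightarrow> m = n"
  using casimir_value_inj by (auto dest: injD)

lemma std_UH_index: "i < n \<Longrightarrow> j < n \<Longrightarrow> std n UH $$ (i, j) = (if i = j then of_nat n - 1 - 2 * of_nat i else 0)"
  using std_generator_mult_index(3)[of i n j 1] by (simp add: std_one)

text \<open>The relation \<open>C = (1 + H) - (1 + H - C)\<close> gives membership in every dimension \<open>n > 1\<close>, where \<open>c\<^sub>n\<close> is not zero.
  In dimension \<open>1\<close> one has \<open>H = 0\<close> and \<open>1 + H\<close> acts as \<open>1\<close>. On the other hand \<open>1\<close> and \<open>H\<close> are independent over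
  \<open>\<complex>[C]\<close>, which forces \<open>z\<^sub>1 + z\<^sub>2 = 0\<close> in every central relation, hence \<open>z\<^sub>0 = - C z\<^sub>2\<close>, and this vanishes at
  \<open>c\<^sub>1 = 0\<close>.\<close>

lemma Loc_not_imp_central_combination:
  defines "p \<equiv> \<lambda>i :: nat. if i = 1 then 1 + UH else 1 + UH - casimir"
  shows "1 \<in> Loc irreps (p ` {1..2})"
    and "\<not> (\<exists>z. central_combination 2 p 1 z \<and> nonvanishing_where_nonzero 1 (z 0))"
proof -
  have two: "{1..2} = {1, 2 :: nat}" by auto
  have p: "p 1 = 1 + UH" "p (Suc 0) = 1 + UH" "p 2 = 1 + UH - casimir"
    by (simp_all add: p_def)
  show "1 \<in> Loc irreps (p ` {1..2})"
    unfolding in_Loc_irreps_iff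
  proof (intro allI impI)
    fix n \<pi> assume irr: "irreducible_rep n \<pi>"
    then have rep: "representation n \<pi>" and n: "n \<ge> 1"
      by (auto simp: irreducible_rep_def)
    note rep_simps = rep_one[OF rep] rep_add[OF rep] rep_diff[OF rep] dim_rep[OF rep]
      irreducible_rep_casimir[OF irr]
    show "\<exists>c. \<forall>a<n. \<forall>b<n. \<pi> 1 $$ (a, b) = (\<Sum>i=1..2. c i * \<pi> (p i) $$ (a, b))"
    proof (cases "n = 1")
      case True
      have "std n UH = 0\<^sub>m n n"
        using True by (intro eq_matI) (simp_all add: std_UH_index)
      then have "\<pi> UH = 0\<^sub>m n n"
        using irreducible_rep_zero_iff[OF irr] by simp
      then show ?thesis
        unfolding two
        by (intro exI[of _ "\<lambda>i. if i = 1 then 1 else 0"]) (auto simp: p rep_simps)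
    next
      case False
      have c1: "casimir_value 1 = 0"
        by (simp add: casimir_value_def)
      have nz: "casimir_value n \<noteq> 0"
        using casimir_value_eq_iff[of n 1] False unfolding c1 by simp
      show ?thesis
        unfolding two
        by (intro exI[of _ "\<lambda>i. if i = 1 then 1 / casimir_value n else - 1 / casimir_value n"])
          (use nz in \<open>auto simp: p rep_simps field_simps\<close>)
    qed
  qed
  show "\<not> (\<exists>z. central_combination 2 p 1 z \<and> nonvanishing_where_nonzero 1 (z 0))"
  proof
    assume "\<exists>z. central_combination 2 p 1 z \<and> nonvanishing_where_nonzero 1 (z 0)"
    then obtain z :: "nat \<Rightarrow> complex poly" where cc: "poly_casimir (z 0) * 1 = poly_casimir (z 1) * p 1 + poly_casimir (z 2) * p 2"
      and nv: "nonvanishing_where_nonzero 1 (z 0)"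
      unfolding central_combination_def two by auto
    have eq: "poly (z 0) (casimir_value n) =
        poly (z 1) (casimir_value n) * (1 + (of_nat n - 1 - 2 * of_nat i)) +
        poly (z 2) (casimir_value n) * (1 + (of_nat n - 1 - 2 * of_nat i) - casimir_value n)"
      if "i < n" for n i
    proof -
      have "std n (poly_casimir (z 0) * 1) $$ (i, i) =
          std n (poly_casimir (z 1) * p 1 + poly_casimir (z 2) * p 2) $$ (i, i)"
        by (simp only: cc)
      then show ?thesis
        using that by (simp only: std_poly_casimir std_add p rep_diff[OF representation_std] std_one std_casimir)
          (simp add: std_UH_index)
    qed
    have "z 1 + z 2 = 0"
    proof (rule ccontr)
      assume nz: "z 1 + z 2 \<noteq> 0"
      obtain n where n: "n \<ge> 2" "poly (z 1 + z 2) (casimir_value n) \<noteq> 0"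
        using casimir_value_nonroot[OF nz] .
      \<comment> \<open>The weights of the first two basis vectors differ by \<open>2\<close>.\<close>
      then have "2 * poly (z 1 + z 2) (casimir_value n) = 0"
        using eq[of 0 n] eq[of 1 n] by (simp add: algebra_simps)
      then show False using n(2) by (simp only: mult_eq_0_iff) simp
    qed
    then have "poly (z 1 + z 2) (casimir_value 1) = 0"
      by simp
    then have "poly (z 0) (casimir_value 1) = 0"
      using eq[of 0 1] by (simp add: casimir_value_def)
    moreover have "rho 1 1 \<noteq> 0\<^sub>m 1 1"
    proof
      assume "rho 1 1 = 0\<^sub>m 1 1"
      then have "std 1 1 = 0\<^sub>m 1 1"
        using irreducible_rep_zero_iff[OF irreducible_rho[of 1]] by simp
      then have "(1\<^sub>m 1 :: complex mat) $$ (0, 0) = 0"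
        by (simp only: std_one) simp
      then show False by simp
    qed
    ultimately show False
      using nv by (auto simp: nonvanishing_where_nonzero_def)
  qed
qed

text \<open>The third element takes care of all dimensions other than \<open>2\<close>. In dimension \<open>2\<close> it vanishes, and one
  compares \<open>H\<close> with \<open>1\<close> and \<open>X\<close>. If the second coordinate of a vector is zero, it is an eigenvector of \<open>H\<close>;
  otherwise \<open>X\<close> moves it to a nonzero multiple of the first basis vector, which corrects the first coordinate of its
  negative. As matrices, however, \<open>1\<close> and \<open>X\<close> have constant diagonal, and \<open>H\<close> does not.\<close>

lemma Ref_not_imp_Loc:
  defines "p \<equiv> \<lambda>i :: nat. if i = 1 then 1 else if i = 2 then UX else poly_casimir [:- casimir_value 2, 1:] * UH"
  shows "UH \<in> Ref irreps (p ` {1..3})" and "UH \<notin> Loc irreps (p ` {1..3})"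
proof -
  have three: "{1..3} = {1, 2, 3 :: nat}" by auto
  have p: "p 1 = 1" "p (Suc 0) = 1" "p 2 = UX" "p 3 = poly_casimir [:- casimir_value 2, 1:] * UH"
    by (simp_all add: p_def)
  show "UH \<in> Ref irreps (p ` {1..3})"
    unfolding in_Ref_irreps_iff
  proof (intro allI impI ballI)
    fix n \<pi> and v :: "complex vec" assume irr: "irreducible_rep n \<pi>" and v: "v \<in> carrier_vec n"
    then have rep: "representation n \<pi>"
      by (auto simp: irreducible_rep_def)
    show "\<exists>c. \<forall>a<n. (\<pi> UH *\<^sub>v v) $ a = (\<Sum>i=1..3. c i * (\<pi> (p i) *\<^sub>v v) $ a)"
    proof (cases "n = 2")
      case False
      define d where "d = casimir_value n - casimir_value 2"
      have d: "d \<noteq> 0"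
        using False by (simp add: d_def casimir_value_eq_iff)
      have "\<pi> (p 3) = d \<cdot>\<^sub>m \<pi> UH"
        by (simp add: p rep_poly_casimir[OF rep irreducible_rep_casimir[OF irr]] d_def)
      then have "\<pi> (p 3) *\<^sub>v v = d \<cdot>\<^sub>v (\<pi> UH *\<^sub>v v)"
        using v rep_scale_vec[OF rep v, of d UH] rep_scale[OF rep, of d UH] by simp
      then have "(\<pi> (p 3) *\<^sub>v v) $ a = d * (\<pi> UH *\<^sub>v v) $ a" if "a < n" for a
        using that by (simp add: dim_rep[OF rep] del: index_mult_mat_vec)
      then show ?thesis
        unfolding three using d
        by (intro exI[of _ "\<lambda>i. if i = 3 then 1 / d else 0"]) (simp del: index_mult_mat_vec)
    next
      case True
      obtain P Q where P: "P \<in> carrier_mat n n" "Q \<in> carrier_mat n n" "P * Q = 1\<^sub>m n"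
        and int: "\<And>u. \<pi> u * P = P * std n u"
        using irreducible_rep_equivalent_std[OF irr] by metis
      define w where "w = Q *\<^sub>v v"
      have w: "w \<in> carrier_vec n"
        using P(2) v by (simp add: w_def)
      have vw: "v = P *\<^sub>v w"
        using assoc_mult_mat_vec[OF P(1,2) v] P(3) v by (simp add: w_def)
      have act: "\<pi> u *\<^sub>v v = P *\<^sub>v (std n u *\<^sub>v w)" for u
        using assoc_mult_mat_vec[OF rep_carrier[OF rep] P(1) w, of u]
          assoc_mult_mat_vec[OF P(1) std_carrier w, of u] int[of u] by (simp add: vw)
      note std_vec = std_generator_mult_vec[OF w[unfolded True]]
      have "\<exists>c d. std n UH *\<^sub>v w = c \<cdot>\<^sub>v w + d \<cdot>\<^sub>v (std n UX *\<^sub>v w)"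
      proof (cases "w $ 1 = 0")
        case w1: True
        have "std n UH *\<^sub>v w = 1 \<cdot>\<^sub>v w + 0 \<cdot>\<^sub>v (std n UX *\<^sub>v w)"
          using w True w1 
          by (intro eq_vecI) (auto simp: std_vec less_2_cases_iff simp del: index_mult_mat_vec)
        then show ?thesis by blast
      next
        case w1: False
        have "std n UH *\<^sub>v w = (- 1) \<cdot>\<^sub>v w + (2 * w $ 0 / w $ 1) \<cdot>\<^sub>v (std n UX *\<^sub>v w)"
          using w True w1
          by (intro eq_vecI) (auto simp: std_vec less_2_cases_iff simp del: index_mult_mat_vec)
        then show ?thesis by blast
      qed
      then obtain c d where cd: "std n UH *\<^sub>v w = c \<cdot>\<^sub>v w + d \<cdot>\<^sub>v (std n UX *\<^sub>v w)"
        by blast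
      have X: "std n UX *\<^sub>v w \<in> carrier_vec n"
        by (rule rep_vec_carrier[OF representation_std])
      have "\<pi> UH *\<^sub>v v = c \<cdot>\<^sub>v v + d \<cdot>\<^sub>v (\<pi> UX *\<^sub>v v)"
        using w X by (simp add: act cd mult_add_distrib_mat_vec[OF P(1)] mult_mat_vec[OF P(1)] flip: vw)
      moreover have "\<pi> (p 1) *\<^sub>v v = v"
        using v by (simp add: p rep_one[OF rep])
      ultimately show ?thesis
        unfolding three using v
        by (intro exI[of _ "\<lambda>i. if i = 1 then c else if i = 2 then d else 0"])
          (simp add: p dim_rep[OF rep] del: index_mult_mat_vec)
    qed
  qed
  show "UH \<notin> Loc irreps (p ` {1..3})"
  proof
    assume "UH \<in> Loc irreps (p ` {1..3})"
    then obtain c where c: "\<And>a b. a < 2 \<Longrightarrow> b < 2 \<Longrightarrow>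
        std 2 UH $$ (a, b) = (\<Sum>i\<in>{1, 2, 3 :: nat}. c i * std 2 (p i) $$ (a, b))"
    proof -
      have "\<exists>c. \<forall>a<2. \<forall>b<2. std 2 UH $$ (a, b) = (\<Sum>i=1..3. c i * std 2 (p i) $$ (a, b))"
        using \<open>UH \<in> Loc irreps (p ` {1..3})\<close>[unfolded in_Loc_irreps_iff]
          irreducible_std[OF one_le_numeral] by blast
      then show ?thesis using that unfolding three by blast
    qed
    have X: "std 2 UX $$ (i, i) = 0" if "i < 2" for i
      using std_generator_mult_index(1)[of i 2 i 1] that by (simp add: std_one)
    have "(if a = 0 then 1 else - 1) = c 1" if "a < 2" for a :: nat
      using c[of a a] that
      by (simp add: p std_poly_casimir std_UH_index X std_one) (auto simp: less_2_cases_iff)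
    from this[of 0] this[of 1] have "(1 :: complex) = - 1"
      by simp
    then show False by simp
  qed
qed

text \<open>The trivial representation kills \<open>C\<close>, although \<open>C\<close> times \<open>1\<close> is a central multiple of \<open>C\<close>.\<close>

lemma central_combination_not_imp_Ref:
  defines "p \<equiv> \<lambda>i :: nat. casimir"
  shows "\<exists>z. central_combination 1 p 1 z" and "1 \<notin> Ref irreps (p ` {1..1})"
proof -
  have "poly_casimir [:0, 1:] = casimir"
    by (simp add: poly_casimir_pCons scaleU_one)
  moreover have "poly_casimir [:0, 1:] \<noteq> 0"
    by (rule poly_casimir_nonzero) simp
  ultimately have "central_combination 1 p 1 (\<lambda>i. if i = 0 then [:0, 1:] else 1)"
    by (simp add: central_combination_def p_def poly_casimir_one)
  then show "\<exists>z. central_combination 1 p 1 z" by blast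
  show "1 \<notin> Ref irreps (p ` {1..1})"
  proof
    assume "1 \<in> Ref irreps (p ` {1..1})"
    then have "\<exists>c. \<forall>a<1. (std 1 1 *\<^sub>v unit_vec 1 0) $ a =
        (\<Sum>i=1..1. c i * (std 1 (p i) *\<^sub>v unit_vec 1 0) $ a)"
      using irreducible_std[OF order_refl] unit_vec_carrier unfolding in_Ref_irreps_iff by blast
    then obtain c :: complex where "(std 1 1 *\<^sub>v unit_vec 1 0) $ 0 = c * (std 1 casimir *\<^sub>v unit_vec 1 0) $ 0"
      unfolding p_def by auto
    moreover have "std 1 casimir = 0\<^sub>m 1 1"
      by (rule eq_matI) (simp_all add: std_casimir casimir_value_def)
    ultimately show False
      by (simp add: std_one)
  qed
qed

theorem theorem4:
  shows
    "(\<forall>k (p :: nat \<Rightarrow> Usl2) q.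
        ((\<exists>z. central_combination k p q z \<and> nonvanishing_where_nonzero q (z 0)) \<longrightarrow>
          q \<in> Loc irreps (p ` {1..k})) \<and>
        (q \<in> Loc irreps (p ` {1..k}) \<longrightarrow> q \<in> Ref irreps (p ` {1..k})) \<and>
        (q \<in> Ref irreps (p ` {1..k}) \<longrightarrow> (\<exists>z. central_combination k p q z))) \<and>
     (\<exists>k\<ge>1. \<exists>(p :: nat \<Rightarrow> Usl2) q.
        q \<in> Loc irreps (p ` {1..k}) \<and>
        \<not> (\<exists>z. central_combination k p q z \<and> nonvanishing_where_nonzero q (z 0))) \<and>
     (\<exists>k\<ge>1. \<exists>(p :: nat \<Rightarrow> Usl2) q.
        q \<in> Ref irreps (p ` {1..k}) \<and> q \<notin> Loc irreps (p ` {1..k})) \<and>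
     (\<exists>k\<ge>1. \<exists>(p :: nat \<Rightarrow> Usl2) q.
        (\<exists>z. central_combination k p q z) \<and> q \<notin> Ref irreps (p ` {1..k}))"
proof (intro conjI allI impI)
  fix k :: nat and p :: "nat \<Rightarrow> Usl2" and q
  assume "\<exists>z. central_combination k p q z \<and> nonvanishing_where_nonzero q (z 0)"
  then show "q \<in> Loc irreps (p ` {1..k})"
    using central_combination_imp_Loc by blast
next
  fix k :: nat and p :: "nat \<Rightarrow> Usl2" and q
  assume "q \<in> Loc irreps (p ` {1..k})"
  then show "q \<in> Ref irreps (p ` {1..k})"
    by (rule Loc_imp_Ref)
next
  fix k :: nat and p :: "nat \<Rightarrow> Usl2" and q
  assume "q \<in> Ref irreps (p ` {1..k})"
  then show "\<exists>z. central_combination k p q z"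
    by (rule Ref_imp_central_combination)
next
  show "\<exists>k\<ge>1. \<exists>(p :: nat \<Rightarrow> Usl2) q.
      q \<in> Loc irreps (p ` {1..k}) \<and>
      \<not> (\<exists>z. central_combination k p q z \<and> nonvanishing_where_nonzero q (z 0))"
    using Loc_not_imp_central_combination one_le_numeral by blast
next
  show "\<exists>k\<ge>1. \<exists>(p :: nat \<Rightarrow> Usl2) q.
      q \<in> Ref irreps (p ` {1..k}) \<and> q \<notin> Loc irreps (p ` {1..k})"
    using Ref_not_imp_Loc one_le_numeral by blast
next
  show "\<exists>k\<ge>1. \<exists>(p :: nat \<Rightarrow> Usl2) q.
      (\<exists>z. central_combination k p q z) \<and> q \<notin> Ref irreps (p ` {1..k})"
    using central_combination_not_imp_Ref order_refl by blast
qed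

end
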